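(* Let $K,N\ge1$ be integers, let $\lambda_k,\beta_k,\rho_o^k,\alpha_L^k,\alpha_N^k,\theta_k>0$ for $k=1,\dots,K$, $P_u>0$ and $\sigma^2\ge0$. In the $K$-tier mmWave uplink model with truncated channel inversion power control described in the context, the SINR outage probability of a typical user in the $j$-th tier, $j\in\{1,\dots,K\}$, is $$\mathcal O_s^j=1-\sum_{n=1}^N(-1)^{n+1}\binom Nn\exp\left(-\frac{\eta n\theta_j\sigma^2}{\rho_o^j\mathcal G_j}-\sum_{k=1}^K\left(Q_n^k+V_n^k\right)\right),$$ where $$Q_n^k=2\pi\lambda_k\sum_{v=1}^4b_v^j(q_v^j)^{\frac{2}{\alpha_L^j}}\int_{\mathcal A_j}^\infty\int_0^{P_u}\mathcal F\left(N,\frac{y^{-\alpha_L^j}}N\right)e^{-\beta_j(q_v^jp)^{1/\alpha_L^j}y}\,y\,p^{\frac{2}{\alpha_L^j}}f_{P_k}(p)\,\mathrm dp\,\mathrm dy,$$ $$V_n^k=2\pi\lambda_k\sum_{v=1}^4b_v^j(q_v^j)^{\frac{2}{\alpha_N^j}}\int_{\mathcal B_j}^\infty\int_0^{P_u}\mathcal F\left(N,\frac{y^{-\alpha_N^j}}N\right)\left(1-e^{-\beta_j(q_v^jp)^{1/\alpha_N^j}y}\right)y\,p^{\frac{2}{\alpha_N^j}}f_{P_k}(p)\,\mathrm dp\,\mathrm dy,$$ with $\eta=N(N!)^{-1/N}$, $\mathcal A_j=\left(\frac{\eta n\theta_ja_v^j\rho_o^k}{\rho_o^j\mathcal G_j}\right)^{-1/\alpha_L^j}$,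 $\mathcal B_j=\left(\frac{\eta n\theta_ja_v^j\rho_o^k}{\rho_o^j\mathcal G_j}\right)^{-1/\alpha_N^j}$, $\mathcal F(N,y)=1-\frac1{(1+y)^N}$ and $q_v^j=\frac{\eta n\theta_ja_v^j}{\rho_o^j\mathcal G_j}$.
   Context: Antenna gains. $G_u^{\max},G_u^{\min}>0$ and $G_{bk}^{\max},G_{bk}^{\min}>0$ are main/side lobe gains (linear scale) of users and of tier-$k$ base stations (BSs), with beamwidths $\zeta_t,\zeta_{rk}\in(0,2\pi]$; $\mathcal G_j=G_{bj}^{\max}G_u^{\max}$. The gain of an interfering link at a tier-$j$ BS equals $a_v^j$ with probability $b_v^j$, $v=1,\dots,4$, where $a_1^j=G_{bj}^{\max}G_u^{\max}$, $a_2^j=G_{bj}^{\max}G_u^{\min}$, $a_3^j=G_{bj}^{\min}G_u^{\max}$, $a_4^j=G_{bj}^{\min}G_u^{\min}$ and $b_1^j=\frac{\zeta_{rj}\zeta_t}{4\pi^2}$, $b_2^j=\frac{\zeta_{rj}}{2\pi}(1-\frac{\zeta_t}{2\pi})$, $b_3^j=(1-\frac{\zeta_{rj}}{2\pi})\frac{\zeta_t}{2\pi}$, $b_4^j=(1-\frac{\zeta_{rj}}{2\pi})(1-\frac{\zeta_t}{2\pi})$. Transmit powers. For each tier $k$, $f_{P_k}$ is the density on $[0,P_u]$ given by $$f_{P_k}(p)=\frac{\frac{\mathrm d}{\mathrm dp}\left[\sum_{c=1}^K\Lambda_c(p/\rho_o^k)\right]}{1-e^{-\sum_{a=1}^K\Lambda_a(P_u/\rho_o^k)}}\,e^{-\sum_{b=1}^K\Lambda_b(p/\rho_o^k)},$$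 $$\Lambda_c(y)=\frac{2\pi\lambda_c}{\beta_c^2}\left(1-e^{-\beta_cy^{1/\alpha_L^c}}(1+\beta_cy^{1/\alpha_L^c})\right)+\pi\lambda_cy^{2/\alpha_N^c}-\frac{2\pi\lambda_c}{\beta_c^2}\left(1-e^{-\beta_cy^{1/\alpha_N^c}}(1+\beta_cy^{1/\alpha_N^c})\right).$$ Interference. The reference BS, of tier $j$, is at the origin. For each $k$, the interfering users associated with tier $k$ form a homogeneous Poisson point process of density $\lambda_k$ in $\mathbb R^2$, independent over $k$. Each tier-$k$ interferer at $u_z$ carries marks, independent across interferers, mutually independent and independent of locations: a transmit power $P_{zk}$ with density $f_{P_k}$; a gain $G_z$ equal to $a_v^j$ with probability $b_v^j$; a fading power $|g_z|^2$, Gamma distributed with shape $N$ and mean $1$. Independently, its link to the reference BS is line-of-sight (LOS) with probability $e^{-\beta_j\|u_z\|}$ and otherwise NLOS. With $\Phi_L^k,\Phi_N^k$ the LOS and NLOS tier-$k$ interferers, $$I_s^k=\sum_{u_z\in\Phi_s^k}\mathbf 1\left(P_{zk}\|u_z\|^{-\alpha_s^j}<\rho_o^k\right)P_{zk}G_z|g_z|^2\|u_z\|^{-\alpha_s^j},\qquad s\in\{L,N\}.$$ SINR outage. The SINR is $\frac{\rho_o^j|g_o|^2\mathcal G_j}{\sigma^2+\sum_k(I_L^k+I_N^k)}$ with $|g_o|^2$ Gamma distributed with shape $N$ and mean $1$, independent of the interference; the outage event is $\{\mathrm{SINR}\le\theta_j\}$. Its probability is evaluated under the approximation that replaces $\mathbb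 P(|g_o|^2<\gamma)$ by $(1-e^{-\eta\gamma})^N$, $\eta=N(N!)^{-1/N}$; that is, $$\mathcal O_s^j:=\mathbb E\left[\left(1-e^{-\frac{\eta\theta_j\left(\sigma^2+\sum_{k=1}^K(I_L^k+I_N^k)\right)}{\rho_o^j\mathcal G_j}}\right)^N\right].$$ The integrals $Q_n^k,V_n^k$ take values in $[0,\infty]$, with $e^{-\infty}=0$. *)

theory Defs
  imports "HOL-Probability.Probability"
begin

section \<open>System parameters\<close>

datatype link = LoS | NLoS

text \<open>Tiers are indexed by \<open>1..ntiers\<close>; \<open>plexp s k\<close> is the path-loss exponent
  \<open>\<alpha>\<^sub>s\<close> of tier \<open>k\<close>; \<open>noise\<close> is the noise power \<open>\<sigma>\<^sup>2\<close>; \<open>rho k\<close> is \<open>\<rho>\<^sub>o\<close> of tier \<open>k\<close>.\<close>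

record uplink =
  ntiers :: nat
  nak :: nat
  lam :: "nat \<Rightarrow> real"
  blk :: "nat \<Rightarrow> real"
  rho :: "nat \<Rightarrow> real"
  plexp :: "link \<Rightarrow> nat \<Rightarrow> real"
  thr :: "nat \<Rightarrow> real"
  pmax :: real
  noise :: real
  gu_max :: real
  gu_min :: real
  gb_max :: "nat \<Rightarrow> real"
  gb_min :: "nat \<Rightarrow> real"
  zeta_t :: real
  zeta_r :: "nat \<Rightarrow> real"

definition valid_uplink :: "uplink \<Rightarrow> bool" where
  "valid_uplink S \<longleftrightarrow>
     1 \<le> ntiers S \<and> 1 \<le> nak S \<and> 0 < pmax S \<and> 0 \<le> noise S \<and>
     0 < gu_max S \<and> 0 < gu_min S \<and> 0 < zeta_t S \<and> zeta_t S \<le> 2 * pi \<and>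
     (\<forall>k\<in>{1..ntiers S}.
        0 < lam S k \<and> 0 < blk S k \<and> 0 < rho S k \<and>
        0 < plexp S LoS k \<and> 0 < plexp S NLoS k \<and> 0 < thr S k \<and>
        0 < gb_max S k \<and> 0 < gb_min S k \<and> 0 < zeta_r S k \<and> zeta_r S k \<le> 2 * pi)"

definition main_gain :: "uplink \<Rightarrow> nat \<Rightarrow> real" where
  "main_gain S j = gb_max S j * gu_max S"

definition gain_val :: "uplink \<Rightarrow> nat \<Rightarrow> nat \<Rightarrow> real" where
  "gain_val S j v =
     [gb_max S j * gu_max S, gb_max S j * gu_min S,
      gb_min S j * gu_max S, gb_min S j * gu_min S] ! (v - 1)"

definition gain_prob :: "uplink \<Rightarrow> nat \<Rightarrow> nat \<Rightarrow> real" where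
  "gain_prob S j v =
     [zeta_r S j * zeta_t S / (4 * pi ^ 2),
      zeta_r S j / (2 * pi) * (1 - zeta_t S / (2 * pi)),
      (1 - zeta_r S j / (2 * pi)) * (zeta_t S / (2 * pi)),
      (1 - zeta_r S j / (2 * pi)) * (1 - zeta_t S / (2 * pi))] ! (v - 1)"

definition Lambda :: "uplink \<Rightarrow> nat \<Rightarrow> real \<Rightarrow> real" where
  "Lambda S c y =
     (let b = blk S c;
          h = (\<lambda>s. 2 * pi * lam S c / b ^ 2 *
                (1 - exp (- b * y powr (1 / plexp S s c)) * (1 + b * y powr (1 / plexp S s c))))
      in h LoS + pi * lam S c * y powr (2 / plexp S NLoS c) - h NLoS)"

definition power_density :: "uplink \<Rightarrow> nat \<Rightarrow> real \<Rightarrow> real" where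
  "power_density S k p =
     (if p \<in> {0..pmax S} then
        deriv (\<lambda>p'. \<Sum>c=1..ntiers S. Lambda S c (p' / rho S k)) p
          / (1 - exp (- (\<Sum>a=1..ntiers S. Lambda S a (pmax S / rho S k))))
          * exp (- (\<Sum>b=1..ntiers S. Lambda S b (p / rho S k)))
      else 0)"

text \<open>Gamma density with integer shape \<open>N\<close> and mean 1, hence rate \<open>N\<close>;
  the first argument of \<^const>\<open>erlang_density\<close> is the shape minus one.\<close>

definition fading_density :: "uplink \<Rightarrow> real \<Rightarrow> real" where
  "fading_density S = erlang_density (nak S - 1) (real (nak S))"

definition eta :: "nat \<Rightarrow> real" where
  "eta N = real N * fact N powr (- 1 / real N)"

section \<open>Homogeneous Poisson point processes in the plane\<close>

text \<open>A point process is given by a measurable enumeration \<open>U 0, U 1, ...\<close> of its points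
  (a homogeneous Poisson process on the plane with positive density has almost surely infinitely
  many points). Almost surely the counts below are finite, so \<^const>\<open>card\<close> is then the
  true number of points. The Poisson probabilities are written out because
  \<^const>\<open>poisson_pmf\<close> does not cover rate 0, that is, Lebesgue null sets.\<close>

type_synonym plane = "real ^ 2"

definition bounded_borel :: "plane set set" where
  "bounded_borel = {B \<in> sets borel. bounded B}"

definition point_count :: "(nat \<Rightarrow> 'w \<Rightarrow> plane) \<Rightarrow> plane set \<Rightarrow> 'w \<Rightarrow> nat" where
  "point_count U B w = card {z. U z w \<in> B}"

definition homogeneous_ppp :: "'w measure \<Rightarrow> real \<Rightarrow> (nat \<Rightarrow> 'w \<Rightarrow> plane) \<Rightarrow> bool" where
  "homogeneous_ppp M l U \<longleftrightarrow>
     (\<forall>z. U z \<in> borel_measurable M) \<and>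
     (AE w in M. \<forall>r. finite {z. norm (U z w) \<le> r}) \<and>
     (\<forall>B\<in>bounded_borel. \<forall>n.
        measure M {w \<in> space M. point_count U B w = n}
          = (l * measure lborel B) ^ n / fact n * exp (- (l * measure lborel B))) \<and>
     (\<forall>(B :: nat \<Rightarrow> plane set) m.
        (\<forall>i<m. B i \<in> bounded_borel) \<and> disjoint_family_on B {..<m} \<longrightarrow>
        prob_space.indep_vars M (\<lambda>_. count_space UNIV) (\<lambda>i. point_count U (B i)) {..<m})"

section \<open>The interfering users\<close>

datatype mark = Power | Gain | Fading

text \<open>The \<open>z\<close>-th interferer of tier \<open>k\<close> has position \<open>U k z\<close>, marks \<open>X m k z\<close> and link
  state \<open>T k z\<close>. First the sigma-algebras generated by all positions and by all marks.\<close>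

definition interferers :: "uplink \<Rightarrow> (nat \<times> nat) set" where
  "interferers S = {1..ntiers S} \<times> UNIV"

definition position_events ::
  "uplink \<Rightarrow> 'w measure \<Rightarrow> (nat \<Rightarrow> nat \<Rightarrow> 'w \<Rightarrow> plane) \<Rightarrow> 'w set set" where
  "position_events S M U =
     sets (vimage_algebra (space M) (\<lambda>w. \<lambda>(k, z)\<in>interferers S. U k z w)
            (Pi\<^sub>M (interferers S) (\<lambda>_. borel)))"

definition mark_events ::
  "uplink \<Rightarrow> 'w measure \<Rightarrow> (mark \<Rightarrow> nat \<Rightarrow> nat \<Rightarrow> 'w \<Rightarrow> real) \<Rightarrow> 'w set set" where
  "mark_events S M X =
     sets (vimage_algebra (space M) (\<lambda>w. \<lambda>(m, k, z)\<in>UNIV \<times> interferers S. X m k z w)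
            (Pi\<^sub>M (UNIV \<times> interferers S) (\<lambda>_. borel)))"

text \<open>In the gain law, some of the four values may coincide. The last conjunct says that,
  conditionally on all positions and marks, the links are independently LOS with probability
  \<open>exp (- \<beta>\<^sub>j * norm u)\<close>; prescribing this for all finite sets of interferers
  determines the joint conditional law of the link states.\<close>

definition interferer_model ::
  "uplink \<Rightarrow> nat \<Rightarrow> 'w measure \<Rightarrow> (nat \<Rightarrow> nat \<Rightarrow> 'w \<Rightarrow> plane) \<Rightarrow>
   (mark \<Rightarrow> nat \<Rightarrow> nat \<Rightarrow> 'w \<Rightarrow> real) \<Rightarrow> (nat \<Rightarrow> nat \<Rightarrow> 'w \<Rightarrow> link) \<Rightarrow> bool" where
  "interferer_model S j M U X T \<longleftrightarrow>
     prob_space M \<and>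
     (\<forall>k\<in>{1..ntiers S}. homogeneous_ppp M (lam S k) (U k)) \<and>
     prob_space.indep_vars M (\<lambda>_. Pi\<^sub>M bounded_borel (\<lambda>_. count_space UNIV))
       (\<lambda>k w. \<lambda>B\<in>bounded_borel. point_count (U k) B w) {1..ntiers S} \<and>
     (\<forall>(k, z)\<in>interferers S.
        distributed M lborel (X Power k z) (\<lambda>p. ennreal (power_density S k p)) \<and>
        distributed M lborel (X Fading k z) (\<lambda>x. ennreal (fading_density S x)) \<and>
        X Gain k z \<in> borel_measurable M \<and>
        (\<forall>A\<in>sets borel. measure M {w \<in> space M. X Gain k z w \<in> A}
           = (\<Sum>v=1..4. gain_prob S j v * indicator A (gain_val S j v))) \<and>
        T k z \<in> measurable M (count_space UNIV)) \<and>
     prob_space.indep_vars M (\<lambda>_. borel) (\<lambda>(m, k, z). X m k z) (UNIV \<times> interferers S) \<and>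
     prob_space.indep_set M (position_events S M U) (mark_events S M X) \<and>
     (\<forall>J\<subseteq>interferers S. finite J \<longrightarrow>
        (AE w in M.
           real_cond_exp M (sigma (space M) (position_events S M U \<union> mark_events S M X))
             (indicator {w \<in> space M. \<forall>(k, z)\<in>J. T k z w = LoS}) w
           = (\<Prod>(k, z)\<in>J. exp (- blk S j * norm (U k z w)))))"

text \<open>Interference, valued in \<open>[0,\<infinity>]\<close>: the sum may diverge, for instance for small
  path-loss exponents. The summands are almost surely nonnegative.\<close>

definition interference ::
  "uplink \<Rightarrow> nat \<Rightarrow> (nat \<Rightarrow> nat \<Rightarrow> 'w \<Rightarrow> plane) \<Rightarrow>
   (mark \<Rightarrow> nat \<Rightarrow> nat \<Rightarrow> 'w \<Rightarrow> real) \<Rightarrow> (nat \<Rightarrow> nat \<Rightarrow> 'w \<Rightarrow> link) \<Rightarrow>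
   link \<Rightarrow> nat \<Rightarrow> 'w \<Rightarrow> ennreal" where
  "interference S j U X T s k w =
     (\<Sum>z. let loss = norm (U k z w) powr (- plexp S s j) in
        if T k z w = s \<and> X Power k z w * loss < rho S k
        then ennreal (X Power k z w * X Gain k z w * X Fading k z w * loss) else 0)"

section \<open>SINR outage probability\<close>

definition exp_neg :: "ennreal \<Rightarrow> real" where
  "exp_neg x = (if x = \<infinity> then 0 else exp (- enn2real x))"

text \<open>The approximation of the distribution function of the desired fading power.\<close>

definition fading_cdf_approx :: "nat \<Rightarrow> ennreal \<Rightarrow> real" where
  "fading_cdf_approx N x = (1 - exp_neg (ennreal (eta N) * x)) ^ N"

text \<open>The SINR is at most the threshold iff the desired fading power is at most
  threshold times noise plus interference, divided by \<open>rho S j * main_gain S j\<close>.\<close>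

definition outage_prob ::
  "uplink \<Rightarrow> nat \<Rightarrow> 'w measure \<Rightarrow> (nat \<Rightarrow> nat \<Rightarrow> 'w \<Rightarrow> plane) \<Rightarrow>
   (mark \<Rightarrow> nat \<Rightarrow> nat \<Rightarrow> 'w \<Rightarrow> real) \<Rightarrow> (nat \<Rightarrow> nat \<Rightarrow> 'w \<Rightarrow> link) \<Rightarrow> real" where
  "outage_prob S j M U X T =
     (\<integral>w. fading_cdf_approx (nak S)
        (ennreal (thr S j / (rho S j * main_gain S j)) *
          (ennreal (noise S) +
            (\<Sum>k=1..ntiers S. interference S j U X T LoS k w + interference S j U X T NLoS k w)))
      \<partial>M)"

section \<open>The integrals of the closed form\<close>

definition calF :: "nat \<Rightarrow> real \<Rightarrow> real" where
  "calF N y = 1 - 1 / (1 + y) ^ N"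

definition q_coef :: "uplink \<Rightarrow> nat \<Rightarrow> nat \<Rightarrow> nat \<Rightarrow> real" where
  "q_coef S j n v =
     eta (nak S) * real n * thr S j * gain_val S j v / (rho S j * main_gain S j)"

text \<open>The lower limits of integration; they also depend on \<open>n\<close>, \<open>v\<close> and \<open>k\<close>.\<close>

definition lower_limit :: "uplink \<Rightarrow> nat \<Rightarrow> link \<Rightarrow> nat \<Rightarrow> nat \<Rightarrow> nat \<Rightarrow> real" where
  "lower_limit S j s n v k =
     (eta (nak S) * real n * thr S j * gain_val S j v * rho S k / (rho S j * main_gain S j))
       powr (- 1 / plexp S s j)"

definition Q_int :: "uplink \<Rightarrow> nat \<Rightarrow> nat \<Rightarrow> nat \<Rightarrow> ennreal" where
  "Q_int S j n k =
     (let N = nak S; \<alpha> = plexp S LoS j; q = q_coef S j n in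
      ennreal (2 * pi * lam S k) *
      (\<Sum>v=1..4. ennreal (gain_prob S j v * q v powr (2 / \<alpha>)) *
        (\<integral>\<^sup>+y\<in>{lower_limit S j LoS n v k..}. (\<integral>\<^sup>+p\<in>{0..pmax S}.
           ennreal (calF N (y powr (- \<alpha>) / real N) *
             exp (- blk S j * (q v * p) powr (1 / \<alpha>) * y) *
             y * p powr (2 / \<alpha>) * power_density S k p) \<partial>lborel) \<partial>lborel)))"

definition V_int :: "uplink \<Rightarrow> nat \<Rightarrow> nat \<Rightarrow> nat \<Rightarrow> ennreal" where
  "V_int S j n k =
     (let N = nak S; \<alpha> = plexp S NLoS j; q = q_coef S j n in
      ennreal (2 * pi * lam S k) *
      (\<Sum>v=1..4. ennreal (gain_prob S j v * q v powr (2 / \<alpha>)) *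
        (\<integral>\<^sup>+y\<in>{lower_limit S j NLoS n v k..}. (\<integral>\<^sup>+p\<in>{0..pmax S}.
           ennreal (calF N (y powr (- \<alpha>) / real N) *
             (1 - exp (- blk S j * (q v * p) powr (1 / \<alpha>) * y)) *
             y * p powr (2 / \<alpha>) * power_density S k p) \<partial>lborel) \<partial>lborel)))"

end

theory Submission
  imports Defs
begin

text \<open>Expanding the \<open>N\<close>-th power by the binomial theorem reduces the outage probability to the Laplace
  transform of the interference at the points \<open>t = \<eta> n \<theta>\<^sub>j / (\<rho>\<^sub>j \<G>\<^sub>j)\<close>. For finitely many interferers, the
  link states, given positions and marks, and then the marks, given the positions, are averaged
  out. What remains is the product of the values of a function of the position only, the mean
  retention, over the interferers. Letting the number of interferers
  grow, the Laplace functional of the Poisson processes gives the exponential of minus the integrals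
  of one minus the mean retention. Polar coordinates and the substitution
  \<open>r = (q p)\<^bsup>1/\<alpha>\<^esup> y\<close> turn these into \<open>Q\<close> and \<open>V\<close>. The Laplace functional itself follows from the
  generating function of the Poisson law when the exponent is a simple function of bounded support,
  and by monotone approximation in general. All exponents take values in \<open>[0,\<infinity>]\<close>, so no
  convergence of sums or integrals is required.\<close>

section \<open>Exponentials of extended nonnegative numbers\<close>

text \<open>The obstacle is the form in which the model is given. No law is assumed for a single
  point \<open>U k z\<close>, since the enumeration is arbitrary: the position law, and the
  independence of the tiers, are prescribed only through counts of bounded Borel sets. The link law
  is prescribed only for finite sets of interferers. So links and marks have to be removed from
  finite products while the positions stay random, whereas the positions can be averaged only over
  the whole process. The bridge is to write the mean retention as \<open>exp_neg g\<close> with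
  \<open>g = - ln retention\<close>: products over the first points of each tier then converge to
  the exponential of a sum over the whole process, and \<open>1 - exp_neg g\<close> is the mean
  deficit, an average over the two link states. This needs a strictly positive retention. The
  function \<open>calF N (t / N)\<close> is 1 minus the Laplace transform at \<open>t\<close> of the
  Gamma law with shape and rate \<open>N\<close>, and the lower limits of integration are the
  truncation of the interference after rescaling.\<close>

lemma exp_neg_ennreal: "0 \<le> x \<Longrightarrow> exp_neg (ennreal x) = exp (- x)"
  by (simp add: exp_neg_def)

lemma exp_neg_top [simp]: "exp_neg \<top> = 0"
  by (simp add: exp_neg_def)

lemma exp_neg_0 [simp]: "exp_neg 0 = 1"
  by (simp add: exp_neg_def)

lemma exp_neg_nonneg [simp]: "0 \<le> exp_neg x"
  by (simp add: exp_neg_def)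

lemma exp_neg_le_1 [simp]: "exp_neg x \<le> 1"
  by (simp add: exp_neg_def)

lemma exp_neg_add: "exp_neg (x + y) = exp_neg x * exp_neg y"
  by (cases x; cases y) (auto simp: exp_neg_def enn2real_plus less_top exp_add[symmetric] top_unique)

lemma exp_neg_sum: "exp_neg (\<Sum>i\<in>A. f i) = (\<Prod>i\<in>A. exp_neg (f i))"
  by (induction A rule: infinite_finite_induct) (auto simp: exp_neg_add)

lemma exp_neg_of_nat_mult: "exp_neg (of_nat n * x) = exp_neg x ^ n"
  by (induction n) (auto simp: exp_neg_add algebra_simps)

lemma measurable_exp_neg [measurable]: "exp_neg \<in> borel_measurable borel"
  unfolding exp_neg_def[abs_def] by measurable

lemma exp_neg_minus_ln: "0 < x \<Longrightarrow> x \<le> 1 \<Longrightarrow> exp_neg (ennreal (- ln x)) = x"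
  by (simp add: exp_neg_ennreal)

lemma exp_neg_mono: "x \<le> y \<Longrightarrow> exp_neg y \<le> exp_neg x"
  by (cases x; cases y) (auto simp: exp_neg_def top_unique)

text \<open>The value 0 at \<open>\<top>\<close> makes \<open>exp_neg\<close> continuous on all of
  \<open>[0,\<infinity>]\<close>, so limits can be taken even where the interference or an exponent
  is infinite.\<close>

lemma tendsto_exp_neg:
  assumes "(f \<longlongrightarrow> L) F"
  shows "((\<lambda>x. exp_neg (f x)) \<longlongrightarrow> exp_neg L) F"
proof (cases "L = \<top>")
  case False
  have fin: "\<forall>\<^sub>F x in F. f x < \<top>"
    using assms False by (intro order_tendstoD) (auto simp: less_top)
  have "((\<lambda>x. exp (- enn2real (f x))) \<longlongrightarrow> exp (- enn2real L)) F"
    using assms False by (intro tendsto_intros tendsto_enn2real) (auto simp: less_top)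
  then show ?thesis
    using False by (auto simp: exp_neg_def elim!: Lim_transform_eventually intro!: eventually_mono[OF fin])
next
  case True
  show ?thesis
  proof (rule order_tendstoI)
    fix a assume "exp_neg L < a"
    then have a: "0 < a"
      using True by simp
    \<comment> \<open>Capping \<open>a\<close> at 1 keeps the threshold nonnegative; the added 1
      yields a factor \<open>exp (- 1)\<close>, which makes the final inequality strict.\<close>
    have "\<forall>\<^sub>F x in F. ennreal (- ln (min a 1)  + 1) < f x"
      using assms True by (intro order_tendstoD) auto
    then show "\<forall>\<^sub>F x in F. exp_neg (f x) < a"
    proof eventually_elim
      case (elim x)
      have "exp_neg (f x) \<le> exp_neg (ennreal (- ln (min a 1) + 1))"
        using elim by (intro exp_neg_mono) auto
      also have "\<dots> = min a 1 * exp (- 1)"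
      proof -
        have "ln (min a 1) \<le> 0"
          using a by simp
        then have "0 \<le> - ln (min a 1) + 1"
          by linarith
        then show ?thesis
          using a by (simp only: exp_neg_ennreal) (simp add: exp_diff exp_minus field_simps)
      qed
      also have "\<dots> < a"
      proof (cases "a \<le> 1")
        case False
        moreover have "exp (- 1 :: real) < 1"
          by simp
        ultimately have "exp (- 1) < a"
          by linarith
        with False show ?thesis
          by (simp add: min_def)
      qed (use a in auto)
      finally show ?case .
    qed
  next
    fix a assume "a < exp_neg L"
    then have "a < exp_neg (f x)" for x
      using True by (simp add: less_le_trans[OF _ exp_neg_nonneg])
    then show "\<forall>\<^sub>F x in F. a < exp_neg (f x)"
      by simp
  qed
qed

lemma exp_neg_suminf: "(\<lambda>n. \<Prod>i<n. exp_neg (f i)) \<longlonglongrightarrow> exp_neg (\<Sum>i. f i)"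
  unfolding exp_neg_sum[symmetric] by (intro tendsto_exp_neg summable_LIMSEQ summableI)

section \<open>The Laplace functional of a Poisson point process\<close>

text \<open>Splitting over the events \<open>N w = n\<close> turns the expectation into
  \<open>exp (- m)\<close> times the exponential series at \<open>m * x\<close>. The computation
  runs in \<open>ennreal\<close>, where sum and integral may be exchanged freely.\<close>

lemma (in prob_space) poisson_generating_function:
  fixes N :: "'a \<Rightarrow> nat" and m x :: real
  assumes [measurable]: "N \<in> measurable M (count_space UNIV)"
    and dist: "\<And>n. prob {w \<in> space M. N w = n} = m ^ n / fact n * exp (- m)"
    and m: "0 \<le> m" and x: "0 \<le> x"
  shows "expectation (\<lambda>w. x ^ N w) = exp (- (m * (1 - x)))"
proof -
  have "(\<integral>\<^sup>+w. ennreal (x ^ N w) \<partial>M)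
      = (\<integral>\<^sup>+w. (\<Sum>n. ennreal (x ^ n) * indicator {w \<in> space M. N w = n} w) \<partial>M)"
  proof (intro nn_integral_cong)
    fix w assume "w \<in> space M"
    then show "ennreal (x ^ N w) = (\<Sum>n. ennreal (x ^ n) * indicator {w \<in> space M. N w = n} w)"
      by (subst suminf_cmult_indicator[where i = "N w"]) (auto simp: disjoint_family_on_def)
  qed
  also have "\<dots> = (\<Sum>n. ennreal (x ^ n) * emeasure M {w \<in> space M. N w = n})"
    by (subst nn_integral_suminf) (auto simp: nn_integral_cmult_indicator)
  also have "\<dots> = (\<Sum>n. ennreal (exp (- m) * ((m * x) ^ n / fact n)))"
    using m x by (intro suminf_cong)
      (auto simp: emeasure_eq_measure dist ennreal_mult[symmetric] power_mult_distrib field_simps)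
  also have "\<dots> = ennreal (exp (- m) * exp (m * x))"
  proof (rule suminf_ennreal_eq)
    show "(\<lambda>n. exp (- m) * ((m * x) ^ n / fact n)) sums (exp (- m) * exp (m * x))"
      using exp_converges[of "m * x"] by (intro sums_mult) (simp add: field_simps scaleR_conv_of_real)
  qed (use m x in auto)
  finally have "(\<integral>\<^sup>+w. ennreal (x ^ N w) \<partial>M) = ennreal (exp (- (m * (1 - x))))"
    by (simp add: exp_add[symmetric] algebra_simps)
  then show ?thesis
    using x by (subst integral_eq_nn_integral) auto
qed

text \<open>Measurability of the counts is contained in the independence clause of
  \<open>homogeneous_ppp\<close>, read for a family of one set.\<close>

lemma homogeneous_ppp_counts:
  assumes "prob_space M" "homogeneous_ppp M l U" "B \<in> bounded_borel"
  shows "point_count U B \<in> measurable M (count_space UNIV)"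
proof -
  interpret prob_space M by fact
  have "prob_space.indep_vars M (\<lambda>_. count_space UNIV) (\<lambda>i. point_count U B) {..<Suc 0}"
    using assms(2,3) unfolding homogeneous_ppp_def
    by (elim conjE allE[of _ "\<lambda>_. B"] allE[of _ "Suc 0"]) (auto simp: disjoint_family_on_def)
  then show ?thesis
    unfolding indep_vars_def by auto
qed

text \<open>The points are grouped by the value of \<open>g\<close>. The value 0 is left out: it
  adds nothing, and its level set carries all but finitely many points.\<close>

lemma point_count_sum:
  fixes g :: "plane \<Rightarrow> ennreal"
  assumes V: "finite (range g)" and fin: "finite {z. g (U z w) \<noteq> 0}"
  shows "(\<Sum>z. g (U z w)) = (\<Sum>c\<in>range g - {0}. of_nat (point_count U (g -` {c}) w) * c)"
proof -
  define F where "F = {z. g (U z w) \<noteq> 0}"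
  have "(\<Sum>z. g (U z w)) = (\<Sum>z\<in>F. g (U z w))"
    using fin by (intro suminf_finite) (auto simp: F_def)
  also have "\<dots> = (\<Sum>c\<in>range g - {0}. \<Sum>z\<in>{z \<in> F. g (U z w) = c}. g (U z w))"
    using V fin by (intro sum.group[symmetric]) (auto simp: F_def)
  also have "\<dots> = (\<Sum>c\<in>range g - {0}. of_nat (point_count U (g -` {c}) w) * c)"
  proof (intro sum.cong refl)
    fix c assume c: "c \<in> range g - {0}"
    then have "{z \<in> F. g (U z w) = c} = {z. U z w \<in> g -` {c}}"
      by (auto simp: F_def)
    then show "(\<Sum>z\<in>{z \<in> F. g (U z w) = c}. g (U z w)) = of_nat (point_count U (g -` {c}) w) * c"
      by (simp add: point_count_def)
  qed
  finally show ?thesis .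
qed

text \<open>The level sets of the nonzero values are disjoint and bounded, so their counts are
  independent Poisson variables and the expectation factors into generating functions. The random
  variable is kept as an explicit function of counts, because the independence of different tiers is
  available only for counts.\<close>

lemma ppp_laplace_simple:
  fixes g :: "plane \<Rightarrow> ennreal"
  assumes "prob_space M" and l: "0 \<le> l" and U: "homogeneous_ppp M l U"
    and g: "simple_function borel g" and bnd: "bounded {u. g u \<noteq> 0}"
  shows "AE w in M. (\<Prod>c\<in>range g - {0}. exp_neg c ^ point_count U (g -` {c}) w)
      = exp_neg (\<Sum>z. g (U z w))"
    and "(\<integral>w. (\<Prod>c\<in>range g - {0}. exp_neg c ^ point_count U (g -` {c}) w) \<partial>M)
      = exp_neg (ennreal l * (\<integral>\<^sup>+u. ennreal (1 - exp_neg (g u)) \<partial>lborel))"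
proof -
  interpret prob_space M by fact
  have V: "finite (range g)" and [measurable]: "g \<in> borel_measurable borel"
    using g by (auto simp: simple_function_def intro: borel_measurable_simple_function)
  obtain r where r: "\<And>u. g u \<noteq> 0 \<Longrightarrow> norm u \<le> r"
    using bnd by (auto simp: bounded_iff)
  have "AE w in M. \<forall>r. finite {z. norm (U z w) \<le> r}"
    using U by (simp add: homogeneous_ppp_def)
  then show "AE w in M. (\<Prod>c\<in>range g - {0}. exp_neg c ^ point_count U (g -` {c}) w)
      = exp_neg (\<Sum>z. g (U z w))"
  proof eventually_elim
    case (elim w)
    have "finite {z. g (U z w) \<noteq> 0}"
      by (rule finite_subset[OF _ elim[rule_format, of r]]) (auto dest: r)
    then show ?case
      by (simp add: point_count_sum[OF V] exp_neg_sum exp_neg_of_nat_mult)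
  qed
  have B: "g -` {c} \<in> bounded_borel" if "c \<noteq> 0" for c
    using that bnd measurable_sets[of g borel borel "{c}"]
    by (auto simp: bounded_borel_def intro: bounded_subset)
  have Bm: "g -` {c} \<in> sets borel" for c
    using measurable_sets[of g borel borel "{c}"] by auto
  \<comment> \<open>\<open>homogeneous_ppp\<close> states independence for families of sets indexed
    by \<open>{..<m}\<close>, so the nonzero values of \<open>g\<close> are numbered by
    \<open>h\<close>.\<close>
  obtain m and h :: "nat \<Rightarrow> ennreal" where h: "bij_betw h {..<m} (range g - {0})"
    using ex_bij_betw_nat_finite[of "range g - {0}"] V by (auto simp: atLeast0LessThan)
  have h0: "h i \<noteq> 0" if "i < m" for i
    using h that by (auto simp: bij_betw_def)
  have "disjoint_family_on (\<lambda>i. g -` {h i}) {..<m}"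
    using h by (auto simp: disjoint_family_on_def bij_betw_def inj_on_def)
  then have "indep_vars (\<lambda>_. count_space UNIV) (\<lambda>i. point_count U (g -` {h i})) {..<m}"
    using U B h0 unfolding homogeneous_ppp_def
    by (elim conjE allE[of _ "\<lambda>i. g -` {h i}"] allE[of _ m]) auto
  then have ind: "indep_vars (\<lambda>_. borel) (\<lambda>i w. exp_neg (h i) ^ point_count U (g -` {h i}) w) {..<m}"
    by (rule indep_vars_compose2[where Y = "\<lambda>i n. exp_neg (h i) ^ n"]) auto
  have cnt: "point_count U (g -` {c}) \<in> measurable M (count_space UNIV)" if "c \<noteq> 0" for c
    using homogeneous_ppp_counts[OF assms(1) U B[OF that]] .
  have pgf: "expectation (\<lambda>w. exp_neg c ^ point_count U (g -` {c}) w)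
      = exp (- (l * measure lborel (g -` {c}) * (1 - exp_neg c)))" if "c \<noteq> 0" for c
    using U B[OF that] cnt[OF that] l unfolding homogeneous_ppp_def
    by (intro poisson_generating_function) auto
  have "(\<integral>w. (\<Prod>c\<in>range g - {0}. exp_neg c ^ point_count U (g -` {c}) w) \<partial>M)
      = (\<integral>w. (\<Prod>i<m. exp_neg (h i) ^ point_count U (g -` {h i}) w) \<partial>M)"
    by (simp add: prod.reindex_bij_betw[OF h, symmetric])
  also have "\<dots> = (\<Prod>i<m. expectation (\<lambda>w. exp_neg (h i) ^ point_count U (g -` {h i}) w))"
  proof (rule indep_vars_lebesgue_integral[OF _ ind])
    fix i assume "i \<in> {..<m}"
    then show "integrable M (\<lambda>w. exp_neg (h i) ^ point_count U (g -` {h i}) w)"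
      using cnt[OF h0[of i]]
      by (intro integrable_const_bound[where B = 1]) (auto intro!: power_le_one)
  qed simp
  also have "\<dots> = (\<Prod>c\<in>range g - {0}. expectation (\<lambda>w. exp_neg c ^ point_count U (g -` {c}) w))"
    by (simp add: prod.reindex_bij_betw[OF h, symmetric])
  also have "\<dots> = (\<Prod>c\<in>range g - {0}. exp (- (l * measure lborel (g -` {c}) * (1 - exp_neg c))))"
    by (intro prod.cong refl pgf) auto
  also have "\<dots> = exp (- (l * (\<Sum>c\<in>range g - {0}. measure lborel (g -` {c}) * (1 - exp_neg c))))"
    by (simp add: exp_sum V sum_negf[symmetric] sum_distrib_left mult.assoc)
  also have "\<dots> = exp_neg (ennreal l * (\<integral>\<^sup>+u. ennreal (1 - exp_neg (g u)) \<partial>lborel))"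
  proof -
    \<comment> \<open>\<open>1 - exp_neg (g u)\<close> is itself a simple function that vanishes
      where \<open>g\<close> does, so its integral is a finite sum over the nonzero values.\<close>
    have "(\<integral>\<^sup>+u. ennreal (1 - exp_neg (g u)) \<partial>lborel)
       = (\<integral>\<^sup>+u. (\<Sum>c\<in>range g - {0}. ennreal (1 - exp_neg c) * indicator (g -` {c}) u) \<partial>lborel)"
    proof (intro nn_integral_cong)
      fix u
      have "(\<Sum>c\<in>range g - {0}. ennreal (1 - exp_neg c) * indicator (g -` {c}) u)
          = (\<Sum>c\<in>range g - {0}. if c = g u then ennreal (1 - exp_neg c) else 0)"
        by (intro sum.cong) auto
      also have "\<dots> = ennreal (1 - exp_neg (g u))"
        using V by (simp add: sum.delta)
      finally show "ennreal (1 - exp_neg (g u))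
        = (\<Sum>c\<in>range g - {0}. ennreal (1 - exp_neg c) * indicator (g -` {c}) u)" by simp
    qed
    also have "\<dots> = (\<Sum>c\<in>range g - {0}. ennreal (1 - exp_neg c) * emeasure lborel (g -` {c}))"
      by (subst nn_integral_sum) (simp_all add: nn_integral_cmult_indicator Bm)
    also have "\<dots> = (\<Sum>c\<in>range g - {0}. ennreal (measure lborel (g -` {c}) * (1 - exp_neg c)))"
    proof (intro sum.cong refl)
      fix c assume "c \<in> range g - {0}"
      then have "emeasure lborel (g -` {c}) = ennreal (measure lborel (g -` {c}))"
        using B[of c] by (intro emeasure_eq_ennreal_measure)
          (auto simp: bounded_borel_def dest: emeasure_bounded_finite)
      then show "ennreal (1 - exp_neg c) * emeasure lborel (g -` {c})
          = ennreal (measure lborel (g -` {c}) * (1 - exp_neg c))"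
        by (simp add: ennreal_mult[symmetric] mult.commute)
    qed
    also have "\<dots> = ennreal (\<Sum>c\<in>range g - {0}. measure lborel (g -` {c}) * (1 - exp_neg c))"
      by (rule sum_ennreal) simp
    finally show ?thesis
      using l by (simp add: ennreal_mult[symmetric] sum_nonneg exp_neg_ennreal)
  qed
  finally show "(\<integral>w. (\<Prod>c\<in>range g - {0}. exp_neg c ^ point_count U (g -` {c}) w) \<partial>M)
      = exp_neg (ennreal l * (\<integral>\<^sup>+u. ennreal (1 - exp_neg (g u)) \<partial>lborel))" .
qed

text \<open>The approximants are measurable functions \<open>\<phi> m\<close> of the whole family of
  counts. In this form the independence of these families over the tiers carries over to them, and
  from them to the limit.\<close>

lemma ppp_laplace_approx:
  fixes g :: "plane \<Rightarrow> ennreal"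
  assumes M: "prob_space M" and l: "0 \<le> l" and U: "homogeneous_ppp M l U"
    and [measurable]: "g \<in> borel_measurable borel"
  obtains \<phi> :: "nat \<Rightarrow> (plane set \<Rightarrow> nat) \<Rightarrow> real" where
    "\<And>m. \<phi> m \<in> borel_measurable (Pi\<^sub>M bounded_borel (\<lambda>_. count_space UNIV))"
    "\<And>m c. 0 \<le> \<phi> m c" "\<And>m c. \<phi> m c \<le> 1"
    "AE w in M. (\<lambda>m. \<phi> m (\<lambda>B\<in>bounded_borel. point_count U B w))
       \<longlonglongrightarrow> exp_neg (\<Sum>z. g (U z w))"
    "(\<lambda>m. \<integral>w. \<phi> m (\<lambda>B\<in>bounded_borel. point_count U B w) \<partial>M)
       \<longlonglongrightarrow> exp_neg (ennreal l * (\<integral>\<^sup>+u. ennreal (1 - exp_neg (g u)) \<partial>lborel))"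
proof -
  obtain G where G: "\<And>i. simple_function borel (G i)" "incseq G" "\<And>x. (SUP i. G i x) = g x"
    using borel_measurable_implies_simple_function_sequence'[OF assms(4)] by metis
  \<comment> \<open>Cutting \<open>G i\<close> off outside the ball of radius \<open>i\<close> gives
    bounded support and still increases to \<open>g\<close>.\<close>
  define H where "H i u = G i u * indicator (cball 0 (real i)) u" for i :: nat and u :: plane
  have H: "simple_function borel (H i)" for i
    unfolding H_def by (intro simple_function_mult G simple_function_indicator) auto
  have [measurable]: "H i \<in> borel_measurable borel" for i
    by (rule borel_measurable_simple_function[OF H])
  have bnd: "bounded {u. H i u \<noteq> 0}" for i
    by (rule bounded_subset[OF bounded_cball[of 0 "real i"]])
      (auto simp: H_def indicator_def split: if_splits)
  have "H i u \<le> H (Suc i) u" for i u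
    unfolding H_def using incseqD[OF G(2), of i "Suc i"]
    by (intro mult_mono) (auto simp: le_fun_def indicator_def)
  then have incH: "incseq (\<lambda>i. H i u)" for u
    by (rule incseq_SucI)
  have SUPH: "(SUP i. H i u) = g u" for u
  proof (rule antisym)
    show "(SUP i. H i u) \<le> g u"
    proof (rule SUP_least)
      fix i
      have "H i u \<le> G i u"
        by (auto simp: H_def indicator_def)
      also have "\<dots> \<le> g u"
        unfolding G(3)[symmetric] by (rule SUP_upper) auto
      finally show "H i u \<le> g u" .
    qed
    obtain n where n: "norm u \<le> real n"
      using real_arch_simple by blast
    show "g u \<le> (SUP i. H i u)"
      unfolding G(3)[symmetric]
    proof (rule SUP_least)
      fix i
      have "G i u \<le> G (max i n) u"
        using incseqD[OF G(2), of i "max i n"] by (auto simp: le_fun_def)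
      also have "\<dots> = H (max i n) u"
        using n by (auto simp: H_def)
      also have "\<dots> \<le> (SUP i. H i u)"
        by (rule SUP_upper) auto
      finally show "G i u \<le> (SUP i. H i u)" .
    qed
  qed
  have limH: "(\<lambda>i. H i u) \<longlonglongrightarrow> g u" for u
    using LIMSEQ_SUP[OF incH[of u]] by (simp add: SUPH)
  define \<phi> where "\<phi> m \<nu> = (\<Prod>c\<in>range (H m) - {0}. exp_neg c ^ \<nu> (H m -` {c}))"
    for m and \<nu> :: "plane set \<Rightarrow> nat"
  have B: "H m -` {c} \<in> bounded_borel" if "c \<noteq> 0" for m c
    using that bnd[of m] measurable_sets[of "H m" borel borel "{c}"]
    by (auto simp: bounded_borel_def intro: bounded_subset)
  have \<phi>: "\<phi> m (\<lambda>B\<in>bounded_borel. point_count U B w)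
      = (\<Prod>c\<in>range (H m) - {0}. exp_neg c ^ point_count U (H m -` {c}) w)" for m w
    unfolding \<phi>_def using B by (intro prod.cong) auto
  show thesis
  proof
    show "\<phi> m \<in> borel_measurable (Pi\<^sub>M bounded_borel (\<lambda>_. count_space UNIV))" for m
      unfolding \<phi>_def
    proof (rule borel_measurable_prod)
      fix c assume "c \<in> range (H m) - {0}"
      then have "(\<lambda>\<nu>. \<nu> (H m -` {c})) \<in>
          measurable (Pi\<^sub>M bounded_borel (\<lambda>_. count_space UNIV :: nat measure)) (count_space UNIV)"
        using B[of c m] by (intro measurable_component_singleton) auto
      then show "(\<lambda>\<nu>. exp_neg c ^ \<nu> (H m -` {c})) \<in>
          borel_measurable (Pi\<^sub>M bounded_borel (\<lambda>_. count_space UNIV :: nat measure))"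
        by (rule measurable_compose) simp
    qed
    show "0 \<le> \<phi> m c" "\<phi> m c \<le> 1" for m c
      by (auto simp: \<phi>_def intro!: prod_nonneg prod_le_1 power_le_one)
    have "AE w in M. \<forall>m. \<phi> m (\<lambda>B\<in>bounded_borel. point_count U B w)
        = exp_neg (\<Sum>z. H m (U z w))"
      unfolding AE_all_countable \<phi> using ppp_laplace_simple(1)[OF M l U H bnd] by blast
    then show "AE w in M. (\<lambda>m. \<phi> m (\<lambda>B\<in>bounded_borel. point_count U B w))
       \<longlonglongrightarrow> exp_neg (\<Sum>z. g (U z w))"
    proof eventually_elim
      case (elim w)
      have "(\<lambda>m. \<Sum>z. H m (U z w)) \<longlonglongrightarrow> (SUP m. \<Sum>z. H m (U z w))"
        using incH by (intro LIMSEQ_SUP) (auto simp: incseq_def intro!: suminf_le)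
      also have "(SUP m. \<Sum>z. H m (U z w)) = (\<Sum>z. g (U z w))"
        unfolding SUPH[symmetric] using incH by (intro ennreal_suminf_SUP_eq[symmetric])
      finally show ?case
        using elim by (simp add: tendsto_exp_neg)
    qed
    \<comment> \<open>Monotone convergence. The limit may be infinite, which the continuity of
      \<open>exp_neg\<close> at \<open>\<top>\<close> absorbs.\<close>
    have "(\<lambda>m. \<integral>\<^sup>+u. ennreal (1 - exp_neg (H m u)) \<partial>lborel)
        \<longlonglongrightarrow> (\<integral>\<^sup>+u. ennreal (1 - exp_neg (g u)) \<partial>lborel)"
      using limH incH
      by (intro nn_integral_LIMSEQ)
        (auto simp: incseq_def le_fun_def intro!: ennreal_leI exp_neg_mono tendsto_intros tendsto_exp_neg)
    then show "(\<lambda>m. \<integral>w. \<phi> m (\<lambda>B\<in>bounded_borel. point_count U B w) \<partial>M)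
       \<longlonglongrightarrow> exp_neg (ennreal l * (\<integral>\<^sup>+u. ennreal (1 - exp_neg (g u)) \<partial>lborel))"
      unfolding \<phi> ppp_laplace_simple(2)[OF M l U H bnd]
      by (intro tendsto_exp_neg ennreal_tendsto_cmult) auto
  qed
qed

text \<open>For each \<open>m\<close> the approximants of the different tiers are independent, so
  their product has the product of their expectations as its mean. Both sides converge, the left one
  by dominated convergence with bound 1.\<close>

lemma ppp_laplace:
  fixes g :: "'i \<Rightarrow> plane \<Rightarrow> ennreal"
  assumes "prob_space M" and I: "finite I"
    and l: "\<And>k. k \<in> I \<Longrightarrow> 0 \<le> l k"
    and U: "\<And>k. k \<in> I \<Longrightarrow> homogeneous_ppp M (l k) (U k)"
    and ind: "prob_space.indep_vars M (\<lambda>_. Pi\<^sub>M bounded_borel (\<lambda>_. count_space UNIV))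
       (\<lambda>k w. \<lambda>B\<in>bounded_borel. point_count (U k) B w) I"
    and g: "\<And>k. k \<in> I \<Longrightarrow> g k \<in> borel_measurable borel"
  shows "(\<integral>w. exp_neg (\<Sum>k\<in>I. \<Sum>z. g k (U k z w)) \<partial>M)
    = exp_neg (\<Sum>k\<in>I. ennreal (l k) * (\<integral>\<^sup>+u. ennreal (1 - exp_neg (g k u)) \<partial>lborel))"
proof -
  interpret prob_space M by fact
  define c where "c k w = (\<lambda>B\<in>bounded_borel. point_count (U k) B w)" for k w
  have "\<forall>k\<in>I. \<exists>\<phi> :: nat \<Rightarrow> (plane set \<Rightarrow> nat) \<Rightarrow> real.
      (\<forall>m. \<phi> m \<in> borel_measurable (Pi\<^sub>M bounded_borel (\<lambda>_. count_space UNIV))) \<and>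
      (\<forall>m x. 0 \<le> \<phi> m x \<and> \<phi> m x \<le> 1) \<and>
      (AE w in M. (\<lambda>m. \<phi> m (c k w)) \<longlonglongrightarrow> exp_neg (\<Sum>z. g k (U k z w))) \<and>
      (\<lambda>m. \<integral>w. \<phi> m (c k w) \<partial>M) \<longlonglongrightarrow>
        exp_neg (ennreal (l k) * (\<integral>\<^sup>+u. ennreal (1 - exp_neg (g k u)) \<partial>lborel))"
  proof
    fix k assume k: "k \<in> I"
    show "\<exists>\<phi> :: nat \<Rightarrow> (plane set \<Rightarrow> nat) \<Rightarrow> real.
      (\<forall>m. \<phi> m \<in> borel_measurable (Pi\<^sub>M bounded_borel (\<lambda>_. count_space UNIV))) \<and>
      (\<forall>m x. 0 \<le> \<phi> m x \<and> \<phi> m x \<le> 1) \<and>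
      (AE w in M. (\<lambda>m. \<phi> m (c k w)) \<longlonglongrightarrow> exp_neg (\<Sum>z. g k (U k z w))) \<and>
      (\<lambda>m. \<integral>w. \<phi> m (c k w) \<partial>M) \<longlonglongrightarrow>
        exp_neg (ennreal (l k) * (\<integral>\<^sup>+u. ennreal (1 - exp_neg (g k u)) \<partial>lborel))"
      unfolding c_def
    proof (rule ppp_laplace_approx[OF assms(1) l[OF k] U[OF k] g[OF k]], goal_cases)
      case (1 \<phi>)
      then show ?case
        by (intro exI[of _ \<phi>] conjI allI)
    qed
  qed
  from bchoice[OF this] obtain \<phi> where \<phi>: "\<forall>k\<in>I.
      (\<forall>m. \<phi> k m \<in> borel_measurable (Pi\<^sub>M bounded_borel (\<lambda>_. count_space UNIV))) \<and>
      (\<forall>m x. 0 \<le> \<phi> k m x \<and> \<phi> k m x \<le> (1::real)) \<and>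
      (AE w in M. (\<lambda>m. \<phi> k m (c k w)) \<longlonglongrightarrow> exp_neg (\<Sum>z. g k (U k z w))) \<and>
      (\<lambda>m. \<integral>w. \<phi> k m (c k w) \<partial>M) \<longlonglongrightarrow>
        exp_neg (ennreal (l k) * (\<integral>\<^sup>+u. ennreal (1 - exp_neg (g k u)) \<partial>lborel))"
    by (rule exE)
  have \<phi>1: "\<phi> k m \<in> borel_measurable (Pi\<^sub>M bounded_borel (\<lambda>_. count_space UNIV))"
    and \<phi>2: "0 \<le> \<phi> k m x \<and> \<phi> k m x \<le> 1"
    and \<phi>3: "AE w in M. (\<lambda>m. \<phi> k m (c k w)) \<longlonglongrightarrow> exp_neg (\<Sum>z. g k (U k z w))"
    and \<phi>4: "(\<lambda>m. \<integral>w. \<phi> k m (c k w) \<partial>M) \<longlonglongrightarrow>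
        exp_neg (ennreal (l k) * (\<integral>\<^sup>+u. ennreal (1 - exp_neg (g k u)) \<partial>lborel))"
    if "k \<in> I" for k m x
    using \<phi>[THEN bspec, OF that] by simp_all
  have ind\<phi>: "indep_vars (\<lambda>_. borel) (\<lambda>k w. \<phi> k m (c k w)) I" for m
    using indep_vars_compose2[OF ind, of "\<lambda>k. \<phi> k m" "\<lambda>_. borel"] \<phi>1 by (simp add: c_def)
  then have meas: "(\<lambda>w. \<phi> k m (c k w)) \<in> borel_measurable M" if "k \<in> I" for k m
    using that unfolding indep_vars_def by auto
  have [measurable]: "U k z \<in> borel_measurable M" if "k \<in> I" for k z
    using U[OF that] by (simp add: homogeneous_ppp_def)
  have [measurable]: "(\<lambda>w. exp_neg (\<Sum>z. g k (U k z w))) \<in> borel_measurable M" if "k \<in> I" for k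
    using that g[OF that] by measurable
  have "(\<lambda>m. \<integral>w. (\<Prod>k\<in>I. \<phi> k m (c k w)) \<partial>M)
      \<longlonglongrightarrow> (\<integral>w. (\<Prod>k\<in>I. exp_neg (\<Sum>z. g k (U k z w))) \<partial>M)"
  proof (rule integral_dominated_convergence[where w = "\<lambda>_. 1"])
    have "AE w in M. \<forall>k\<in>I. (\<lambda>m. \<phi> k m (c k w)) \<longlonglongrightarrow> exp_neg (\<Sum>z. g k (U k z w))"
      using I \<phi>3 by (simp add: AE_finite_all)
    then show "AE w in M. (\<lambda>m. \<Prod>k\<in>I. \<phi> k m (c k w))
        \<longlonglongrightarrow> (\<Prod>k\<in>I. exp_neg (\<Sum>z. g k (U k z w)))"
      by eventually_elim (auto intro!: tendsto_prod)
    show "AE w in M. norm (\<Prod>k\<in>I. \<phi> k m (c k w)) \<le> 1" for m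
      using \<phi>2 by (auto simp: abs_prod intro!: prod_le_1)
  qed (use meas in \<open>auto intro!: borel_measurable_prod\<close>)
  moreover have "(\<integral>w. (\<Prod>k\<in>I. \<phi> k m (c k w)) \<partial>M) = (\<Prod>k\<in>I. \<integral>w. \<phi> k m (c k w) \<partial>M)" for m
    using I ind\<phi> meas \<phi>2
    by (intro indep_vars_lebesgue_integral) (auto intro!: integrable_const_bound[where B = 1])
  moreover have "(\<lambda>m. \<Prod>k\<in>I. \<integral>w. \<phi> k m (c k w) \<partial>M) \<longlonglongrightarrow>
      (\<Prod>k\<in>I. exp_neg (ennreal (l k) * (\<integral>\<^sup>+u. ennreal (1 - exp_neg (g k u)) \<partial>lborel)))"
    using \<phi>4 by (intro tendsto_prod)
  ultimately show ?thesis
    unfolding exp_neg_sum by (simp add: LIMSEQ_unique)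
qed

section \<open>Radial integrals and Gamma-distributed fading\<close>

text \<open>The disc of radius \<open>a\<close> has area \<open>pi * a\<^sup>2\<close>, the integral
  of \<open>2 * pi * r\<close> over \<open>{0..a}\<close>; the half-lines \<open>{..a}\<close> form
  an intersection-stable generator of the Borel sets.\<close>

lemma distr_norm_plane:
  "distr lborel borel (norm :: plane \<Rightarrow> real)
    = density lborel (\<lambda>r. ennreal (2 * pi * r) * indicator {0..} r)"
proof (rule measure_eqI_generator_eq[where E = "range atMost" and \<Omega> = UNIV
      and A = "\<lambda>n. {.. real n}"])
  show "Int_stable (range (atMost :: real \<Rightarrow> real set))"
    by (auto simp: Int_stable_def)
  have *: "emeasure (distr lborel borel (norm :: plane \<Rightarrow> real)) {..a}
    = (if 0 \<le> a then ennreal (pi * a\<^sup>2) else 0)" for a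
  proof (cases "0 \<le> a")
    case True
    have "(norm :: plane \<Rightarrow> real) -` {..a} = cball 0 a"
      by auto
    then show ?thesis
      using True by (simp add: emeasure_distr emeasure_cball eval_unit_ball_vol)
  next
    case False
    have "(norm :: plane \<Rightarrow> real) -` {..a} = {}"
      using False by (auto intro: order_trans[OF norm_ge_zero])
    then show ?thesis
      using False by (simp add: emeasure_distr)
  qed
  show "emeasure (distr lborel borel (norm :: plane \<Rightarrow> real)) {.. real n} \<noteq> \<infinity>" for n
    by (simp add: *)
  fix B :: "real set"
  assume "B \<in> range atMost"
  then obtain a where B: "B = {..a}"
    by auto
  show "emeasure (distr lborel borel (norm :: plane \<Rightarrow> real)) B
    = emeasure (density lborel (\<lambda>r. ennreal (2 * pi * r) * indicator {0..} r)) B"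
  proof (cases "0 \<le> a")
    case True
    have "emeasure (density lborel (\<lambda>r. ennreal (2 * pi * r) * indicator {0..} r)) B
        = (\<integral>\<^sup>+r. ennreal (2 * pi * r) * indicator {0..a} r \<partial>lborel)"
      unfolding B by (subst emeasure_density)
        (auto intro!: nn_integral_cong simp: indicator_def)
    also have "\<dots> = ennreal (pi * a\<^sup>2 - pi * 0\<^sup>2)"
      using True by (intro nn_integral_FTC_Icc) (auto intro!: derivative_eq_intros)
    finally show ?thesis
      using True by (simp add: B *)
  next
    case False
    then have "emeasure (density lborel (\<lambda>r. ennreal (2 * pi * r) * indicator {0..} r)) B = 0"
      unfolding B by (subst emeasure_density) (auto intro!: nn_integral_zero' simp: indicator_def)
    then show ?thesis
      using False by (simp add: B *)
  qed
next
  show "(\<Union>n. {.. real n}) = UNIV"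
    by (auto intro: real_arch_simple)
qed (auto simp: borel_eq_atMost)

lemma nn_integral_norm_plane:
  assumes [measurable]: "f \<in> borel_measurable borel"
  shows "(\<integral>\<^sup>+u. f (norm (u :: plane)) \<partial>lborel)
    = (\<integral>\<^sup>+r\<in>{0..}. ennreal (2 * pi * r) * f r \<partial>lborel)"
proof -
  have "(\<integral>\<^sup>+u. f (norm (u :: plane)) \<partial>lborel) = (\<integral>\<^sup>+r. f r \<partial>distr lborel borel (norm :: plane \<Rightarrow> real))"
    by (rule nn_integral_distr[symmetric]) auto
  also have "\<dots> = (\<integral>\<^sup>+r\<in>{0..}. ennreal (2 * pi * r) * f r \<partial>lborel)"
    unfolding distr_norm_plane by (subst nn_integral_density) (auto simp: ac_simps)
  finally show ?thesis .
qed

text \<open>Exponential tilting: multiplying the density of rate \<open>l\<close> by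
  \<open>exp (- (t * x))\<close> gives a constant times the density of rate \<open>l + t\<close>,
  which has total mass 1. The exponent is \<open>Suc k\<close> because the first argument of
  \<open>erlang_density\<close> is the shape minus one.\<close>

lemma nn_integral_erlang_laplace:
  assumes l: "0 < l" and t: "0 \<le> t"
  shows "(\<integral>\<^sup>+x. ennreal (exp (- (t * x)) * erlang_density k l x) \<partial>lborel)
    = ennreal (1 / (1 + t / l) ^ Suc k)"
proof -
  have "exp (- (t * x)) * erlang_density k l x = (l / (l + t)) ^ Suc k * erlang_density k (l + t) x" for x
  proof -
    have 1: "l ^ Suc k = (l / (l + t)) ^ Suc k * (l + t) ^ Suc k"
      using l t by (simp only: power_mult_distrib[symmetric]) simp
    have 2: "exp (- (l + t) * x) = exp (- (t * x)) * exp (- l * x)"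
      by (simp add: exp_add[symmetric] algebra_simps)
    show ?thesis
      unfolding erlang_density_def 2 by (simp only: 1) (simp del: power_Suc)
  qed
  then have "(\<integral>\<^sup>+x. ennreal (exp (- (t * x)) * erlang_density k l x) \<partial>lborel)
    = ennreal ((l / (l + t)) ^ Suc k) * (\<integral>\<^sup>+x. ennreal (erlang_density k (l + t) x) \<partial>lborel)"
    using l t by (subst nn_integral_cmult[symmetric]) (simp_all add: ennreal_mult'[symmetric] del: power_Suc)
  also have "(\<integral>\<^sup>+x. ennreal (erlang_density k (l + t) x) \<partial>lborel) = 1"
    using nn_integral_erlang_ith_moment[of "l + t" k 0] l t by simp
  also have "l / (l + t) = 1 / (1 + t / l)"
    using l t by (simp add: field_simps)
  finally show ?thesis
    by (simp add: power_one_over)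
qed

lemma calF_nonneg: "0 \<le> x \<Longrightarrow> 0 \<le> calF N x"
  by (simp add: calF_def one_le_power)

lemma measurable_calF [measurable]: "calF N \<in> borel_measurable borel"
  unfolding calF_def[abs_def] by measurable

text \<open>This is where \<open>calF\<close> comes from: mean 1 and shape \<open>N\<close> force
  the rate \<open>N\<close>, so the Laplace transform at \<open>t\<close> is
  \<open>1 / (1 + t / N) ^ N\<close>.\<close>

lemma nn_integral_erlang_calF:
  assumes N: "1 \<le> N" and t: "0 \<le> t"
  shows "(\<integral>\<^sup>+x. ennreal ((1 - exp (- (t * x))) * erlang_density (N - 1) (real N) x) \<partial>lborel)
    = ennreal (calF N (t / real N))"
proof -
  let ?e = "erlang_density (N - 1) (real N)"
  have N': "Suc (N - 1) = N" "0 < real N"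
    using N by auto
  have "(\<integral>\<^sup>+x. ennreal ((1 - exp (- (t * x))) * ?e x) \<partial>lborel)
     = (\<integral>\<^sup>+x. ennreal (?e x) - ennreal (exp (- (t * x)) * ?e x) \<partial>lborel)"
    using N t by (intro nn_integral_cong)
      (auto simp: ennreal_minus algebra_simps)
  also have "\<dots> = (\<integral>\<^sup>+x. ennreal (?e x) \<partial>lborel) - (\<integral>\<^sup>+x. ennreal (exp (- (t * x)) * ?e x) \<partial>lborel)"
  proof (rule nn_integral_diff)
    show "(\<integral>\<^sup>+x. ennreal (exp (- (t * x)) * ?e x) \<partial>lborel) \<noteq> \<infinity>"
      using nn_integral_erlang_laplace[OF N'(2) t, of "N - 1"] by simp
    show "AE x in lborel. ennreal (exp (- (t * x)) * ?e x) \<le> ennreal (?e x)"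
    proof (intro AE_I2 ennreal_leI)
      fix x show "exp (- (t * x)) * ?e x \<le> ?e x"
      proof (cases "x < 0")
        case False
        then show ?thesis
          using t by (intro mult_left_le_one_le) auto
      qed (simp add: erlang_density_def)
    qed
  qed auto
  also have "\<dots> = ennreal 1 - ennreal (1 / (1 + t / real N) ^ N)"
    using nn_integral_erlang_laplace[OF N'(2) t, of "N - 1"]
      nn_integral_erlang_ith_moment[OF N'(2), of "N - 1" 0] N' by simp
  also have "\<dots> = ennreal (calF N (t / real N))"
    using N t by (subst ennreal_minus) (auto simp: calF_def)
  finally show ?thesis .
qed

text \<open>For fixed \<open>p > 0\<close>, put \<open>r = c * y\<close> with
  \<open>c = (q * p) powr (1 / \<alpha>)\<close>. Then \<open>q * p * r powr (- \<alpha>)\<close>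
  becomes \<open>y powr (- \<alpha>)\<close>, so neither the argument of \<open>calF\<close> nor the
  truncation depends on \<open>p\<close> any more: the condition reads
  \<open>y > (q * \<rho>) powr (- 1 / \<alpha>)\<close>. The measure \<open>r dr\<close> contributes
  \<open>c * c\<close>, the source of \<open>q powr (2 / \<alpha>)\<close> and
  \<open>p powr (2 / \<alpha>)\<close>. As the substitution depends on \<open>p\<close>, the order
  of integration is exchanged before it and restored afterwards.\<close>

lemma radial_rescale:
  fixes F :: "real \<Rightarrow> ennreal" and \<omega> :: "real \<Rightarrow> real"
  assumes [measurable]: "F \<in> borel_measurable borel" "\<omega> \<in> borel_measurable borel"
    and \<omega>: "\<And>r. 0 \<le> r \<Longrightarrow> 0 \<le> \<omega> r"
    and pos: "0 < q" "0 < \<alpha>" "0 < \<rho>"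
  shows "(\<integral>\<^sup>+r\<in>{0..}. ennreal r * (ennreal (\<omega> r) * (\<integral>\<^sup>+p\<in>{0..P}.
        (if p * r powr (- \<alpha>) < \<rho> then ennreal (calF N (q * p * r powr (- \<alpha>) / real N)) else 0) * F p
          \<partial>lborel)) \<partial>lborel)
    = ennreal (q powr (2 / \<alpha>)) * (\<integral>\<^sup>+y\<in>{(q * \<rho>) powr (- 1 / \<alpha>)..}. (\<integral>\<^sup>+p\<in>{0..P}.
        ennreal (calF N (y powr (- \<alpha>) / real N) * \<omega> ((q * p) powr (1 / \<alpha>) * y) * y * p powr (2 / \<alpha>)) * F p
          \<partial>lborel) \<partial>lborel)" (is "?L = ?R")
proof -
  define A where "A r p = ennreal r * (ennreal (\<omega> r) *
    (if p * r powr (- \<alpha>) < \<rho> then ennreal (calF N (q * p * r powr (- \<alpha>) / real N)) else 0)) * indicator {0..} r" for r p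
  define B where "B y p = ennreal (calF N (y powr (- \<alpha>) / real N) * \<omega> ((q * p) powr (1 / \<alpha>) * y) * y * p powr (2 / \<alpha>))
    * indicator {(q * \<rho>) powr (- 1 / \<alpha>)..} y" for y p
  have [measurable]: "case_prod A \<in> borel_measurable (borel \<Otimes>\<^sub>M borel)"
      "case_prod B \<in> borel_measurable (borel \<Otimes>\<^sub>M borel)"
    unfolding A_def[abs_def] B_def[abs_def] by measurable
  have inner: "(\<integral>\<^sup>+r. A r p \<partial>lborel) = ennreal (q powr (2 / \<alpha>)) * (\<integral>\<^sup>+y. B y p \<partial>lborel)" if p: "0 < p" for p
  proof -
    define c where "c = (q * p) powr (1 / \<alpha>)"
    have c: "0 < c"
      using pos p by (simp add: c_def)
    have "c powr (- \<alpha>) = (q * p) powr (- 1)"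
      using pos by (simp add: c_def powr_powr)
    also have "\<dots> = 1 / (q * p)"
      using pos p by (simp add: powr_minus_divide)
    finally have ca: "c powr (- \<alpha>) = 1 / (q * p)" .
    have c2: "c * c = q powr (2 / \<alpha>) * p powr (2 / \<alpha>)"
      using pos p by (simp add: c_def powr_mult powr_add[symmetric] field_simps)
    have "(\<integral>\<^sup>+r. A r p \<partial>lborel) = ennreal \<bar>c\<bar> * (\<integral>\<^sup>+y. A (0 + c * y) p \<partial>lborel)"
      using c by (intro nn_integral_real_affine) auto
    also have "\<dots> = (\<integral>\<^sup>+y. ennreal c * A (c * y) p \<partial>lborel)"
      using c by (subst nn_integral_cmult) auto
    also have "\<dots> = (\<integral>\<^sup>+y. ennreal (q powr (2 / \<alpha>)) * B y p \<partial>lborel)"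
    proof (rule nn_integral_cong_AE)
      \<comment> \<open>The truncation is strict while the range of integration is closed, so the
        boundary value is discarded; without 0, every remaining nonpositive \<open>y\<close> is
        negative and both indicators vanish there.\<close>
      have "AE y in lborel. y \<noteq> (q * \<rho>) powr (- 1 / \<alpha>)" "AE y in lborel. y \<noteq> (0::real)"
        by (auto simp: AE_lborel_singleton)
      then show "AE y in lborel. ennreal c * A (c * y) p = ennreal (q powr (2 / \<alpha>)) * B y p"
      proof eventually_elim
        case (elim y)
        show ?case
        proof (cases "0 < y")
          case False
          have "0 < (q * \<rho>) powr (- 1 / \<alpha>)"
            using pos by simp
          then have "y < (q * \<rho>) powr (- 1 / \<alpha>)"
            using False by linarith
          then show ?thesis
            using False elim c by (simp add: A_def B_def mult_le_0_iff zero_le_mult_iff)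
        next
          case True
          have yc: "(c * y) powr (- \<alpha>) = y powr (- \<alpha>) / (q * p)"
            using True c by (simp add: powr_mult ca)
          have "p * (c * y) powr (- \<alpha>) < \<rho> \<longleftrightarrow> y powr (- \<alpha>) < q * \<rho>"
            unfolding yc using pos p by (simp add: field_simps)
          also have "\<dots> \<longleftrightarrow> (q * \<rho>) powr (- 1 / \<alpha>) < y"
          proof -
            have "y powr (- \<alpha>) < q * \<rho> \<longleftrightarrow> (q * \<rho>) powr (- 1 / \<alpha>) < (y powr (- \<alpha>)) powr (- 1 / \<alpha>)"
              using pos True mult_pos_pos[of q \<rho>] powr_less_mono2_neg[of "- 1 / \<alpha>" "y powr (- \<alpha>)" "q * \<rho>"]
                powr_mono2'[of "- 1 / \<alpha>" "q * \<rho>" "y powr (- \<alpha>)"]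
              by (auto simp: not_less[symmetric])
            also have "(y powr (- \<alpha>)) powr (- 1 / \<alpha>) = y"
              using pos True by (simp add: powr_powr)
            finally show ?thesis .
          qed
          finally have iff: "p * (c * y) powr (- \<alpha>) < \<rho> \<longleftrightarrow> (q * \<rho>) powr (- 1 / \<alpha>) \<le> y"
            using elim by auto
          have qp: "q * p * (c * y) powr (- \<alpha>) = y powr (- \<alpha>)"
            unfolding yc using pos p by simp
          have K: "0 \<le> calF N (y powr (- \<alpha>) / real N)"
            by (intro calF_nonneg) auto
          have W: "0 \<le> \<omega> (c * y)"
            using \<omega> c True by simp
          show ?thesis
          proof (cases "(q * \<rho>) powr (- 1 / \<alpha>) \<le> y")
            case le: True
            have "ennreal c * A (c * y) p = ennreal (c * (c * y * (\<omega> (c * y) * calF N (y powr (- \<alpha>) / real N))))"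
              using True c le iff qp K W by (simp add: A_def ennreal_mult)
            also have "c * (c * y * (\<omega> (c * y) * calF N (y powr (- \<alpha>) / real N)))
                = (c * c) * (calF N (y powr (- \<alpha>) / real N) * \<omega> (c * y) * y)"
              by (simp add: ac_simps)
            also have "\<dots> = q powr (2 / \<alpha>) * (calF N (y powr (- \<alpha>) / real N) * \<omega> (c * y) * y * p powr (2 / \<alpha>))"
              by (simp add: c2 ac_simps)
            also have "ennreal \<dots> = ennreal (q powr (2 / \<alpha>)) * B y p"
              using le by (simp add: B_def c_def[symmetric] ennreal_mult')
            finally show ?thesis .
          qed (use iff in \<open>simp add: A_def B_def\<close>)
        qed
      qed
    qed
    also have "\<dots> = ennreal (q powr (2 / \<alpha>)) * (\<integral>\<^sup>+y. B y p \<partial>lborel)"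
      by (subst nn_integral_cmult) auto
    finally show ?thesis .
  qed
  have "?L = (\<integral>\<^sup>+r. (\<integral>\<^sup>+p. A r p * (F p * indicator {0..P} p) \<partial>lborel) \<partial>lborel)"
    unfolding A_def
    by (subst nn_integral_cmult[symmetric] nn_integral_multc[symmetric], measurable)+
      (auto intro!: nn_integral_cong simp: ac_simps)
  also have "\<dots> = (\<integral>\<^sup>+p. (\<integral>\<^sup>+r. A r p * (F p * indicator {0..P} p) \<partial>lborel) \<partial>lborel)"
    by (rule lborel_pair.Fubini') auto
  also have "\<dots> = (\<integral>\<^sup>+p. ennreal (q powr (2 / \<alpha>)) * (\<integral>\<^sup>+y. B y p * (F p * indicator {0..P} p) \<partial>lborel) \<partial>lborel)"
  proof (rule nn_integral_cong_AE)
    \<comment> \<open>The substitution degenerates at \<open>p = 0\<close>; negative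
      \<open>p\<close> are removed by the indicator of \<open>{0..P}\<close>.\<close>
    have "AE p in lborel. p \<noteq> (0::real)"
      by (rule AE_lborel_singleton)
    then show "AE p in lborel. (\<integral>\<^sup>+r. A r p * (F p * indicator {0..P} p) \<partial>lborel)
      = ennreal (q powr (2 / \<alpha>)) * (\<integral>\<^sup>+y. B y p * (F p * indicator {0..P} p) \<partial>lborel)"
    proof eventually_elim
      case (elim p)
      show ?case
      proof (cases "0 < p")
        case True
        then show ?thesis
          by (simp add: nn_integral_multc inner mult.assoc)
      qed (use elim in simp)
    qed
  qed
  also have "\<dots> = ennreal (q powr (2 / \<alpha>)) * (\<integral>\<^sup>+p. (\<integral>\<^sup>+y. B y p * (F p * indicator {0..P} p) \<partial>lborel) \<partial>lborel)"
    by (rule nn_integral_cmult) measurable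
  also have "(\<integral>\<^sup>+p. (\<integral>\<^sup>+y. B y p * (F p * indicator {0..P} p) \<partial>lborel) \<partial>lborel)
     = (\<integral>\<^sup>+y. (\<integral>\<^sup>+p. B y p * (F p * indicator {0..P} p) \<partial>lborel) \<partial>lborel)"
    by (rule lborel_pair.Fubini'[symmetric]) auto
  also have "\<dots> = (\<integral>\<^sup>+y\<in>{(q * \<rho>) powr (- 1 / \<alpha>)..}. (\<integral>\<^sup>+p\<in>{0..P}.
        ennreal (calF N (y powr (- \<alpha>) / real N) * \<omega> ((q * p) powr (1 / \<alpha>) * y) * y * p powr (2 / \<alpha>)) * F p
          \<partial>lborel) \<partial>lborel)"
    unfolding B_def
    by (subst nn_integral_multc[symmetric], measurable) (auto intro!: nn_integral_cong simp: ac_simps)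
  finally show ?thesis .
qed

section \<open>Averaging over links and marks\<close>

text \<open>\<^const>\<open>prob_space.indep_var\<close> requires both variables to have the same type.\<close>

lemma (in prob_space) nn_integral_indep_pair:
  assumes Y[measurable]: "Y \<in> measurable M A" and Z[measurable]: "Z \<in> measurable M B"
    and ind: "indep_set {Y -` a \<inter> space M | a. a \<in> sets A} {Z -` b \<inter> space M | b. b \<in> sets B}"
    and f[measurable]: "case_prod f \<in> borel_measurable (A \<Otimes>\<^sub>M B)"
  shows "(\<integral>\<^sup>+w. f (Y w) (Z w) \<partial>M) = (\<integral>\<^sup>+w. (\<integral>\<^sup>+w'. f (Y w) (Z w') \<partial>M) \<partial>M)"
proof -
  interpret Y: prob_space "distr M A Y"
    by (rule prob_space_distr) measurable
  interpret Z: prob_space "distr M B Z"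
    by (rule prob_space_distr) measurable
  have "distr M A Y \<Otimes>\<^sub>M distr M B Z = distr M (A \<Otimes>\<^sub>M B) (\<lambda>w. (Y w, Z w))"
  proof (rule pair_measure_eqI)
    fix a b assume "a \<in> sets (distr M A Y)" "b \<in> sets (distr M B Z)"
    then have ab [measurable]: "a \<in> sets A" "b \<in> sets B"
      by auto
    have "prob ((Y -` a \<inter> space M) \<inter> (Z -` b \<inter> space M)) = prob (Y -` a \<inter> space M) * prob (Z -` b \<inter> space M)"
      using ab by (intro indep_setD[OF ind]) auto
    moreover have "(\<lambda>w. (Y w, Z w)) -` (a \<times> b) \<inter> space M = (Y -` a \<inter> space M) \<inter> (Z -` b \<inter> space M)"
      by auto
    ultimately show "emeasure (distr M A Y) a * emeasure (distr M B Z) b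
        = emeasure (distr M (A \<Otimes>\<^sub>M B) (\<lambda>w. (Y w, Z w))) (a \<times> b)"
      by (simp add: emeasure_distr emeasure_eq_measure ennreal_mult)
  qed (auto intro: Y.sigma_finite_measure_axioms Z.sigma_finite_measure_axioms)
  note joint = this
  have "(\<integral>\<^sup>+w. f (Y w) (Z w) \<partial>M) = (\<integral>\<^sup>+x. case_prod f x \<partial>distr M (A \<Otimes>\<^sub>M B) (\<lambda>w. (Y w, Z w)))"
    by (subst nn_integral_distr) auto
  also have "\<dots> = (\<integral>\<^sup>+x. case_prod f x \<partial>(distr M A Y \<Otimes>\<^sub>M distr M B Z))"
    by (simp add: joint)
  also have "\<dots> = (\<integral>\<^sup>+y. (\<integral>\<^sup>+z. f y z \<partial>distr M B Z) \<partial>distr M A Y)"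
    by (subst Z.nn_integral_fst[symmetric]) auto
  also have "\<dots> = (\<integral>\<^sup>+w. (\<integral>\<^sup>+z. f (Y w) z \<partial>distr M B Z) \<partial>M)"
    by (subst nn_integral_distr) auto
  also have "\<dots> = (\<integral>\<^sup>+w. (\<integral>\<^sup>+w'. f (Y w) (Z w') \<partial>M) \<partial>M)"
    by (intro nn_integral_cong) (subst nn_integral_distr, auto dest: measurable_space[of Y M A])
  finally show ?thesis .
qed

lemma (in prob_space) nn_integral_indep_var:
  assumes ind: "indep_var A Y B Z" and f: "case_prod f \<in> borel_measurable (A \<Otimes>\<^sub>M B)"
  shows "(\<integral>\<^sup>+w. f (Y w) (Z w) \<partial>M) = (\<integral>\<^sup>+w. (\<integral>\<^sup>+w'. f (Y w) (Z w') \<partial>M) \<partial>M)"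
proof (rule nn_integral_indep_pair[OF indep_var_rv1[OF ind] indep_var_rv2[OF ind] _ f])
  show "indep_set {Y -` a \<inter> space M | a. a \<in> sets A} {Z -` b \<inter> space M | b. b \<in> sets B}"
    using ind unfolding indep_var_eq indep_set_def
    by (elim conjE indep_sets_mono_sets) (auto split: bool.split)
qed

section \<open>The interferer model and the sigma-algebra of positions and marks\<close>

locale uplink_interferers = prob_space M
  for M :: "'w measure" +
  fixes S :: uplink and j :: nat
    and U :: "nat \<Rightarrow> nat \<Rightarrow> 'w \<Rightarrow> plane"
    and X :: "mark \<Rightarrow> nat \<Rightarrow> nat \<Rightarrow> 'w \<Rightarrow> real"
    and T :: "nat \<Rightarrow> nat \<Rightarrow> 'w \<Rightarrow> link"
  assumes valid: "valid_uplink S" and j: "j \<in> {1..ntiers S}"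
    and model: "interferer_model S j M U X T"
begin

definition positions :: "'w \<Rightarrow> nat \<times> nat \<Rightarrow> plane" where
  "positions w = (\<lambda>(k, z)\<in>interferers S. U k z w)"

definition marks :: "'w \<Rightarrow> mark \<times> nat \<times> nat \<Rightarrow> real" where
  "marks w = (\<lambda>(m, k, z)\<in>UNIV \<times> interferers S. X m k z w)"

definition position_mark_algebra :: "'w measure" where
  "position_mark_algebra = sigma (space M) (position_events S M U \<union> mark_events S M X)"

lemma ppp: "k \<in> {1..ntiers S} \<Longrightarrow> homogeneous_ppp M (lam S k) (U k)"
  using model by (auto simp: interferer_model_def)

lemma indep_counts: "indep_vars (\<lambda>_. Pi\<^sub>M bounded_borel (\<lambda>_. count_space UNIV))
       (\<lambda>k w. \<lambda>B\<in>bounded_borel. point_count (U k) B w) {1..ntiers S}"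
  using model by (simp add: interferer_model_def)

lemma indep_marks: "indep_vars (\<lambda>_. borel) (\<lambda>(m, k, z). X m k z) (UNIV \<times> interferers S)"
  using model by (simp add: interferer_model_def)

lemma indep_events: "indep_set (position_events S M U) (mark_events S M X)"
  using model by (simp add: interferer_model_def)

lemma measurable_U: "(k, z) \<in> interferers S \<Longrightarrow> U k z \<in> borel_measurable M"
  using ppp[of k] by (auto simp: interferers_def homogeneous_ppp_def)

lemma measurable_X: "(k, z) \<in> interferers S \<Longrightarrow> X m k z \<in> borel_measurable M"
  using indep_marks unfolding indep_vars_def by fastforce

lemma measurable_T: "(k, z) \<in> interferers S \<Longrightarrow> T k z \<in> measurable M (count_space UNIV)"
  using model by (auto simp: interferer_model_def)

lemma power_law: "(k, z) \<in> interferers S \<Longrightarrow>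
    distributed M lborel (X Power k z) (\<lambda>p. ennreal (power_density S k p))"
  using model by (auto simp: interferer_model_def)

lemma fading_law: "(k, z) \<in> interferers S \<Longrightarrow>
    distributed M lborel (X Fading k z) (\<lambda>x. ennreal (fading_density S x))"
  using model by (auto simp: interferer_model_def)

lemma gain_law: "(k, z) \<in> interferers S \<Longrightarrow> A \<in> sets borel \<Longrightarrow>
    prob {w \<in> space M. X Gain k z w \<in> A} = (\<Sum>v=1..4. gain_prob S j v * indicator A (gain_val S j v))"
  using model by (auto simp: interferer_model_def)

lemma link_law: "J \<subseteq> interferers S \<Longrightarrow> finite J \<Longrightarrow>
    AE w in M. real_cond_exp M position_mark_algebra (indicator {w \<in> space M. \<forall>(k, z)\<in>J. T k z w = LoS}) w
      = (\<Prod>(k, z)\<in>J. exp (- blk S j * norm (U k z w)))"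
  using model unfolding position_mark_algebra_def by (simp add: interferer_model_def)

lemma measurable_positions: "positions \<in> measurable M (Pi\<^sub>M (interferers S) (\<lambda>_. borel))"
  unfolding positions_def using measurable_U by (intro measurable_restrict) auto

lemma measurable_marks: "marks \<in> measurable M (Pi\<^sub>M (UNIV \<times> interferers S) (\<lambda>_. borel))"
  unfolding marks_def using measurable_X by (intro measurable_restrict) auto

text \<open>The form as preimages under one random variable lets the independence of positions and
  marks be used as a Fubini rule.\<close>

lemma position_events_eq:
  "position_events S M U = {positions -` A \<inter> space M | A. A \<in> sets (Pi\<^sub>M (interferers S) (\<lambda>_. borel))}"
  unfolding position_events_def positions_def[abs_def, symmetric]
  using measurable_space[OF measurable_positions] by (intro sets_vimage_algebra2) auto

lemma mark_events_eq:
  "mark_events S M X = {marks -` A \<inter> space M | A. A \<in> sets (Pi\<^sub>M (UNIV \<times> interferers S) (\<lambda>_. borel))}"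
  unfolding mark_events_def marks_def[abs_def, symmetric]
  using measurable_space[OF measurable_marks] by (intro sets_vimage_algebra2) auto

lemma PM_subalgebra: "subalgebra M position_mark_algebra"
proof -
  have "position_events S M U \<union> mark_events S M X \<subseteq> sets M"
    unfolding position_events_eq mark_events_eq
    using measurable_sets[OF measurable_positions] measurable_sets[OF measurable_marks] by auto
  moreover from this have "position_events S M U \<union> mark_events S M X \<subseteq> Pow (space M)"
    using sets.sets_into_space by blast
  ultimately show ?thesis
    by (simp add: subalgebra_def position_mark_algebra_def sets.sigma_sets_subset)
qed

lemma space_position_mark_algebra [simp]: "space position_mark_algebra = space M"
  using PM_subalgebra by (simp add: subalgebra_def)

lemma PM_generators: "position_events S M U \<subseteq> sets position_mark_algebra" "mark_events S M X \<subseteq> sets position_mark_algebra"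
proof -
  have "position_events S M U \<union> mark_events S M X \<subseteq> Pow (space M)"
    unfolding position_events_eq mark_events_eq by auto
  then show "position_events S M U \<subseteq> sets position_mark_algebra" "mark_events S M X \<subseteq> sets position_mark_algebra"
    unfolding position_mark_algebra_def by auto
qed

lemma PM_positions: "positions \<in> measurable position_mark_algebra (Pi\<^sub>M (interferers S) (\<lambda>_. borel))"
  using measurable_space[OF measurable_positions] PM_generators(1)
  by (intro measurableI) (auto simp: position_events_eq)

lemma PM_marks: "marks \<in> measurable position_mark_algebra (Pi\<^sub>M (UNIV \<times> interferers S) (\<lambda>_. borel))"
  using measurable_space[OF measurable_marks] PM_generators(2)
  by (intro measurableI) (auto simp: mark_events_eq)

lemma PM_U:
  assumes "(k, z) \<in> interferers S" shows "U k z \<in> borel_measurable position_mark_algebra"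
proof -
  have "(\<lambda>w. positions w (k, z)) \<in> borel_measurable position_mark_algebra"
    using assms by (intro measurable_compose[OF PM_positions]) auto
  then show ?thesis
    using assms by (simp add: positions_def)
qed

lemma PM_X:
  assumes "(k, z) \<in> interferers S" shows "X m k z \<in> borel_measurable position_mark_algebra"
proof -
  have "(\<lambda>w. marks w (m, k, z)) \<in> borel_measurable position_mark_algebra"
    using assms by (intro measurable_compose[OF PM_marks]) auto
  then show ?thesis
    using assms by (simp add: marks_def)
qed

lemma nn_integral_positions_marks:
  assumes "case_prod f \<in> borel_measurable
    (Pi\<^sub>M (interferers S) (\<lambda>_. borel) \<Otimes>\<^sub>M Pi\<^sub>M (UNIV \<times> interferers S) (\<lambda>_. borel))"
  shows "(\<integral>\<^sup>+w. f (positions w) (marks w) \<partial>M) = (\<integral>\<^sup>+w. (\<integral>\<^sup>+w'. f (positions w) (marks w') \<partial>M) \<partial>M)"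
  using indep_events unfolding position_events_eq mark_events_eq
  by (rule nn_integral_indep_pair[OF measurable_positions measurable_marks _ assms])

section \<open>Averaging over the link states\<close>

definition los_prob :: "nat \<times> nat \<Rightarrow> 'w \<Rightarrow> real" where
  "los_prob i w = exp (- blk S j * norm (U (fst i) (snd i) w))"

lemma blk_pos: "0 < blk S j"
  using valid j by (auto simp: valid_uplink_def)

lemma los_prob_bounds: "0 \<le> los_prob i w" "los_prob i w \<le> 1"
  using blk_pos by (auto simp: los_prob_def)

lemma PM_los_prob: "i \<in> interferers S \<Longrightarrow> los_prob i \<in> borel_measurable position_mark_algebra"
  unfolding los_prob_def[abs_def] using PM_U[of "fst i" "snd i"] by simp

text \<open>The model gives only the conditional probability that all links of a finite set are LOS.
  Hence each factor is written as \<open>D NLoS\<close> plus the LOS indicator times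
  \<open>D LoS - D NLoS\<close>, and the product is expanded over the subsets \<open>K\<close> of
  \<open>J\<close>. The coefficient of each joint LOS event depends on positions and marks only, so
  conditioning replaces the event by a product of LOS probabilities; the expansion is then folded
  back.\<close>

lemma average_links:
  fixes D :: "link \<Rightarrow> nat \<times> nat \<Rightarrow> 'w \<Rightarrow> real"
  assumes J: "J \<subseteq> interferers S" "finite J"
    and D: "\<And>s i. i \<in> J \<Longrightarrow> D s i \<in> borel_measurable position_mark_algebra"
    and D1: "\<And>s i w. i \<in> J \<Longrightarrow> \<bar>D s i w\<bar> \<le> 1"
  shows "expectation (\<lambda>w. \<Prod>i\<in>J. D (T (fst i) (snd i) w) i w)
    = expectation (\<lambda>w. \<Prod>i\<in>J. los_prob i w * D LoS i w + (1 - los_prob i w) * D NLoS i w)"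
proof -
  interpret PM: finite_measure_subalgebra M position_mark_algebra
    by unfold_locales (rule PM_subalgebra)
  \<comment> \<open>\<open>c K\<close> is the coefficient, in this expansion, of the event
    \<open>L K\<close> that all links in \<open>K\<close> are LOS.\<close>
  define c where "c K w = (\<Prod>i\<in>K. D LoS i w - D NLoS i w) * (\<Prod>i\<in>J - K. D NLoS i w)" for K w
  define L where "L K = {w \<in> space M. \<forall>(k, z)\<in>K. T k z w = LoS}" for K
  have fin: "finite K" if "K \<subseteq> J" for K
    using that J(2) by (rule finite_subset)
  have c_meas: "c K \<in> borel_measurable position_mark_algebra" if "K \<subseteq> J" for K
    unfolding c_def using that D by (intro borel_measurable_times borel_measurable_prod borel_measurable_diff) auto
  then have c_meas': "c K \<in> borel_measurable M" if "K \<subseteq> J" for K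
    using that measurable_from_subalg[OF PM_subalgebra] by blast
  have c_bound: "\<bar>c K w\<bar> \<le> 2 ^ card K" if "K \<subseteq> J" for K w
  proof -
    \<comment> \<open>Two numbers in \<open>[-1,1]\<close> differ by at most 2; the resulting bound
      \<open>2 ^ card K\<close> only has to secure integrability.\<close>
    have "\<bar>D LoS i w - D NLoS i w\<bar> \<le> 2" if "i \<in> J" for i
      using D1[OF that, of LoS w] D1[OF that, of NLoS w] by linarith
    then have "(\<Prod>i\<in>K. \<bar>D LoS i w - D NLoS i w\<bar>) \<le> (\<Prod>i\<in>K. 2)"
      using that by (intro prod_mono) auto
    moreover have "(\<Prod>i\<in>J - K. \<bar>D NLoS i w\<bar>) \<le> 1"
      using D1 by (intro prod_le_1) auto
    ultimately have "(\<Prod>i\<in>K. \<bar>D LoS i w - D NLoS i w\<bar>) * (\<Prod>i\<in>J - K. \<bar>D NLoS i w\<bar>) \<le> 2 ^ card K * 1"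
      by (intro mult_mono) (auto intro: prod_nonneg)
    then show ?thesis
      by (simp add: c_def abs_mult abs_prod)
  qed
  have L_sets [measurable]: "L K \<in> sets M" if "K \<subseteq> J" for K
  proof -
    have T: "T (fst i) (snd i) -` {LoS} \<inter> space M \<in> sets M" if "i \<in> K" for i
      using that \<open>K \<subseteq> J\<close> J(1) by (intro measurable_sets[OF measurable_T]) auto
    show ?thesis
    proof (cases "K = {}")
      case False
      have "L K = (\<Inter>i\<in>K. T (fst i) (snd i) -` {LoS} \<inter> space M)"
        using False by (auto simp: L_def)
      then show ?thesis
        using sets.finite_INT[OF fin[OF that] False T] by simp
    qed (simp add: L_def)
  qed
  have integrable: "integrable M (\<lambda>w. c K w * indicator (L K) w)" if "K \<subseteq> J" for K
    using c_meas'[OF that] c_bound[OF that] L_sets[OF that]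
    by (intro integrable_const_bound[where B = "2 ^ card K"])
      (auto simp: indicator_def)
  have "(\<lambda>w. \<Prod>i\<in>K. los_prob i w) \<in> borel_measurable M" if "K \<subseteq> J" for K
    using that J PM_los_prob measurable_from_subalg[OF PM_subalgebra]
    by (intro borel_measurable_prod) blast
  then have integrable': "integrable M (\<lambda>w. c K w * (\<Prod>i\<in>K. los_prob i w))" if "K \<subseteq> J" for K
  proof (intro integrable_const_bound[where B = "2 ^ card K"] AE_I2)
    fix w
    have "\<bar>c K w\<bar> * (\<Prod>i\<in>K. los_prob i w) \<le> 2 ^ card K * 1"
      using c_bound[OF that] by (intro mult_mono prod_le_1 prod_nonneg) (auto simp: los_prob_bounds)
    then show "norm (c K w * (\<Prod>i\<in>K. los_prob i w)) \<le> 2 ^ card K"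
      by (simp add: abs_mult abs_prod los_prob_bounds)
  qed (use c_meas' that in auto)
  have "expectation (\<lambda>w. \<Prod>i\<in>J. D (T (fst i) (snd i) w) i w)
    = expectation (\<lambda>w. \<Sum>K\<in>Pow J. c K w * indicator (L K) w)"
  proof (intro Bochner_Integration.integral_cong refl)
    fix w assume w: "w \<in> space M"
    have ind: "(\<Prod>i\<in>K. indicator (L {i}) w) = (indicator (L K) w :: real)" if "K \<subseteq> J" for K
      using fin[OF that] w by (induction K rule: finite_induct) (auto simp: L_def indicator_def)
    have "(\<Prod>i\<in>J. D (T (fst i) (snd i) w) i w)
      = (\<Prod>i\<in>J. indicator (L {i}) w * (D LoS i w - D NLoS i w) + D NLoS i w)"
    proof (intro prod.cong refl)
      fix i
      show "D (T (fst i) (snd i) w) i w = indicator (L {i}) w * (D LoS i w - D NLoS i w) + D NLoS i w"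
        using w by (cases "T (fst i) (snd i) w") (auto simp: L_def indicator_def)
    qed
    also have "\<dots> = (\<Sum>K\<in>Pow J. (\<Prod>i\<in>K. indicator (L {i}) w * (D LoS i w - D NLoS i w)) * (\<Prod>i\<in>J - K. D NLoS i w))"
      using J(2) by (rule prod_add)
    also have "\<dots> = (\<Sum>K\<in>Pow J. c K w * indicator (L K) w)"
      by (intro sum.cong refl) (simp add: prod.distrib c_def ind)
    finally show "(\<Prod>i\<in>J. D (T (fst i) (snd i) w) i w) = (\<Sum>K\<in>Pow J. c K w * indicator (L K) w)" .
  qed
  also have "\<dots> = (\<Sum>K\<in>Pow J. expectation (\<lambda>w. c K w * indicator (L K) w))"
    using integrable by (intro Bochner_Integration.integral_sum) auto
  also have "\<dots> = (\<Sum>K\<in>Pow J. expectation (\<lambda>w. c K w * (\<Prod>i\<in>K. los_prob i w)))"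
  proof (intro sum.cong refl)
    fix K assume "K \<in> Pow J"
    then have K: "K \<subseteq> J" by simp
    \<comment> \<open>\<open>c K\<close> is measurable for \<open>position_mark_algebra\<close>, so
      it acts as a constant under the conditional expectation.\<close>
    have "expectation (\<lambda>w. c K w * indicator (L K) w)
        = expectation (\<lambda>w. c K w * real_cond_exp M position_mark_algebra (indicator (L K)) w)"
      using integrable[OF K] c_meas[OF K] L_sets[OF K]
      by (intro PM.real_cond_exp_intg(2)[symmetric]) auto
    also have "\<dots> = expectation (\<lambda>w. c K w * (\<Prod>i\<in>K. los_prob i w))"
    proof (rule integral_cong_AE)
      have "AE w in M. real_cond_exp M position_mark_algebra (indicator (L K)) w = (\<Prod>i\<in>K. los_prob i w)"
        using link_law[of K] K J fin[OF K] by (simp add: L_def los_prob_def case_prod_beta)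
      then show "AE w in M. c K w * real_cond_exp M position_mark_algebra (indicator (L K)) w
          = c K w * (\<Prod>i\<in>K. los_prob i w)"
        by eventually_elim simp
      show "(\<lambda>w. c K w * (\<Prod>i\<in>K. los_prob i w)) \<in> borel_measurable M"
        using integrable'[OF K] by auto
      show "(\<lambda>w. c K w * real_cond_exp M position_mark_algebra (indicator (L K)) w) \<in> borel_measurable M"
        using c_meas'[OF K] by simp
    qed
    finally show "expectation (\<lambda>w. c K w * indicator (L K) w)
        = expectation (\<lambda>w. c K w * (\<Prod>i\<in>K. los_prob i w))" .
  qed
  also have "\<dots> = expectation (\<lambda>w. \<Sum>K\<in>Pow J. c K w * (\<Prod>i\<in>K. los_prob i w))"
    using integrable' by (intro Bochner_Integration.integral_sum[symmetric]) auto
  also have "\<dots> = expectation (\<lambda>w. \<Prod>i\<in>J. los_prob i w * (D LoS i w - D NLoS i w) + D NLoS i w)"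
    by (subst prod_add[OF J(2)]) (simp add: prod.distrib c_def ac_simps)
  finally show ?thesis
    by (simp add: algebra_simps)
qed

end

section \<open>Signs of the parameters and the total gain probability\<close>

lemma valid_uplinkD:
  assumes "valid_uplink S"
  shows "1 \<le> nak S" "0 \<le> noise S"
    and "k \<in> {1..ntiers S} \<Longrightarrow> 0 < lam S k" "k \<in> {1..ntiers S} \<Longrightarrow> 0 < rho S k"
    and "k \<in> {1..ntiers S} \<Longrightarrow> 0 < plexp S s k" "k \<in> {1..ntiers S} \<Longrightarrow> 0 < thr S k"
  using assms by (auto simp: valid_uplink_def) (cases s; auto)

lemma main_gain_pos: "valid_uplink S \<Longrightarrow> j \<in> {1..ntiers S} \<Longrightarrow> 0 < main_gain S j"
  by (auto simp: valid_uplink_def main_gain_def)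

lemma atLeastAtMost_1_4: "{1..4::nat} = {1, 2, 3, 4}"
  by auto

lemma gain_val_pos:
  assumes "valid_uplink S" "j \<in> {1..ntiers S}" "v \<in> {1..4}"
  shows "0 < gain_val S j v"
  using assms unfolding atLeastAtMost_1_4 by (auto simp: valid_uplink_def gain_val_def)

lemma gain_prob_nonneg:
  assumes "valid_uplink S" "j \<in> {1..ntiers S}" "v \<in> {1..4}"
  shows "0 \<le> gain_prob S j v"
proof -
  have "0 \<le> zeta_r S j" "zeta_r S j \<le> 2 * pi" "0 \<le> zeta_t S" "zeta_t S \<le> 2 * pi"
    using assms(1,2) by (auto simp: valid_uplink_def less_imp_le)
  then show ?thesis
    using assms(3) unfolding atLeastAtMost_1_4
    by (auto simp: gain_prob_def intro!: divide_nonneg_pos mult_nonneg_nonneg)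
qed

text \<open>The four numbers are products of two binary laws: main lobe or not at the base station,
  and main lobe or not at the user.\<close>

lemma gain_prob_sum: "(\<Sum>v=1..4. gain_prob S j v) = 1"
  unfolding atLeastAtMost_1_4 by (simp add: gain_prob_def field_simps power2_eq_square)

section \<open>Averaging over gain, fading and power of one interferer\<close>

context uplink_interferers
begin

text \<open>Since some of the four values may coincide, the integral is first split over the set
  \<open>V\<close> of distinct values; exchanging the two sums then redistributes each value over
  its indices \<open>v\<close>.\<close>

lemma gain_average:
  assumes i: "(k, z) \<in> interferers S" and f [measurable]: "f \<in> borel_measurable borel"
  shows "(\<integral>\<^sup>+w. f (X Gain k z w) \<partial>M) = (\<Sum>v=1..4. ennreal (gain_prob S j v) * f (gain_val S j v))"
proof -
  define V where "V = gain_val S j ` {1..4}"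
  have V: "finite V" "V \<in> sets borel"
    by (auto simp: V_def intro!: borel_closed finite_imp_closed)
  have [measurable]: "X Gain k z \<in> borel_measurable M"
    by (rule measurable_X[OF i])
  note law = gain_law[OF i]
  \<comment> \<open>The law has total mass 1 on \<open>V\<close>, so the gain takes no other value
    almost surely.\<close>
  have "prob {w \<in> space M. X Gain k z w \<in> V} = (\<Sum>v=1..4. gain_prob S j v)"
    unfolding law[OF V(2)] by (intro sum.cong) (auto simp: V_def)
  also have "\<dots> = 1"
    by (rule gain_prob_sum)
  finally have inV: "AE w in M. X Gain k z w \<in> V"
    using V(2) by (subst AE_iff_emeasure_eq_1)
      (auto simp: emeasure_eq_measure)
  have "(\<integral>\<^sup>+w. f (X Gain k z w) \<partial>M)
      = (\<integral>\<^sup>+w. (\<Sum>a\<in>V. f a * indicator {w \<in> space M. X Gain k z w \<in> {a}} w) \<partial>M)"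
  proof (rule nn_integral_cong_AE, use inV AE_space in eventually_elim)
    case (elim w)
    have "(\<Sum>a\<in>V. f a * indicator {w \<in> space M. X Gain k z w \<in> {a}} w)
        = (\<Sum>a\<in>V. if a = X Gain k z w then f a else 0)"
      using elim by (intro sum.cong) auto
    then show ?case
      using elim V(1) by simp
  qed
  also have "\<dots> = (\<Sum>a\<in>V. f a * emeasure M {w \<in> space M. X Gain k z w \<in> {a}})"
    by (subst nn_integral_sum) (auto simp: nn_integral_cmult_indicator simp del: singleton_iff)
  also have "\<dots> = (\<Sum>a\<in>V. \<Sum>v=1..4. f a * (ennreal (gain_prob S j v) * indicator {a} (gain_val S j v)))"
  proof (intro sum.cong refl)
    fix a
    have "emeasure M {w \<in> space M. X Gain k z w \<in> {a}}
        = ennreal (\<Sum>v=1..4. gain_prob S j v * indicator {a} (gain_val S j v))"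
      unfolding emeasure_eq_measure by (subst law) auto
    also have "\<dots> = (\<Sum>v=1..4. ennreal (gain_prob S j v * indicator {a} (gain_val S j v)))"
      using gain_prob_nonneg[OF valid j] by (intro sum_ennreal[symmetric]) auto
    also have "\<dots> = (\<Sum>v=1..4. ennreal (gain_prob S j v) * indicator {a} (gain_val S j v))"
      by (intro sum.cong refl) (simp add: indicator_def)
    finally show "f a * emeasure M {w \<in> space M. X Gain k z w \<in> {a}}
      = (\<Sum>v=1..4. f a * (ennreal (gain_prob S j v) * indicator {a} (gain_val S j v)))"
      by (simp only: sum_distrib_left)
  qed
  also have "\<dots> = (\<Sum>v=1..4. \<Sum>a\<in>V. f a * (ennreal (gain_prob S j v) * indicator {a} (gain_val S j v)))"
    by (rule sum.swap)
  also have "\<dots> = (\<Sum>v=1..4. ennreal (gain_prob S j v) * f (gain_val S j v))"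
  proof (intro sum.cong refl)
    fix v :: nat assume "v \<in> {1..4}"
    then have v: "gain_val S j v \<in> V"
      by (auto simp: V_def)
    have "(\<Sum>a\<in>V. f a * (ennreal (gain_prob S j v) * indicator {a} (gain_val S j v)))
        = (\<Sum>a\<in>V. if a = gain_val S j v then f a * ennreal (gain_prob S j v) else 0)"
      by (intro sum.cong) auto
    then show "(\<Sum>a\<in>V. f a * (ennreal (gain_prob S j v) * indicator {a} (gain_val S j v)))
        = ennreal (gain_prob S j v) * f (gain_val S j v)"
      using v V(1) by (simp add: mult.commute)
  qed
  finally show ?thesis .
qed

lemma measurable_fading_density [measurable]: "fading_density S \<in> borel_measurable borel"
  by (simp add: fading_density_def)

text \<open>Independence separates the power from the other two marks, then gain from fading; each
  mark is afterwards integrated against its own law. The power becomes the outermost variable, the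
  place that the density has in the closed form.\<close>

lemma mark_average:
  assumes i: "(k, z) \<in> interferers S"
    and \<psi> [measurable]: "(\<lambda>(p, g, x). \<psi> p g x) \<in> borel_measurable (borel \<Otimes>\<^sub>M borel \<Otimes>\<^sub>M borel)"
  shows "(\<integral>\<^sup>+w. \<psi> (X Power k z w) (X Gain k z w) (X Fading k z w) \<partial>M)
    = (\<integral>\<^sup>+p. ennreal (power_density S k p) * (\<Sum>v=1..4. ennreal (gain_prob S j v) *
        (\<integral>\<^sup>+x. ennreal (fading_density S x) * \<psi> p (gain_val S j v) x \<partial>lborel)) \<partial>lborel)"
proof -
  have [measurable]: "X m k z \<in> borel_measurable M" for m
    by (rule measurable_X[OF i])
  have 1: "(\<integral>\<^sup>+w. \<psi> (X Power k z w) (X Gain k z w) (X Fading k z w) \<partial>M)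
      = (\<integral>\<^sup>+w. (\<integral>\<^sup>+w'. \<psi> (X Power k z w) (X Gain k z w') (X Fading k z w') \<partial>M) \<partial>M)"
  proof -
    \<comment> \<open>Both groups of marks are taken as functions on mark indices, which gives one
      and two marks the common type that \<open>indep_var\<close> demands.\<close>
    define A B where "A = {(Power, k, z)}" and "B = {(Gain, k, z), (Fading, k, z)}"
    have ind: "indep_var (Pi\<^sub>M A (\<lambda>_. borel)) (\<lambda>w. \<lambda>i\<in>A. (\<lambda>(m, k, z). X m k z) i w)
        (Pi\<^sub>M B (\<lambda>_. borel)) (\<lambda>w. \<lambda>i\<in>B. (\<lambda>(m, k, z). X m k z) i w)"
      by (rule indep_var_restrict[OF indep_marks]) (use i in \<open>auto simp: A_def B_def\<close>)
    have mem: "(Power, k, z) \<in> A" "(Gain, k, z) \<in> B" "(Fading, k, z) \<in> B"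
      by (auto simp: A_def B_def)
    have mA: "(\<lambda>x. fst x i) \<in> borel_measurable (Pi\<^sub>M A (\<lambda>_. borel) \<Otimes>\<^sub>M Pi\<^sub>M B (\<lambda>_. borel))" if "i \<in> A"
      for i :: "mark \<times> nat \<times> nat"
      by (rule measurable_compose[OF measurable_fst measurable_component_singleton[OF that]])
    have mB: "(\<lambda>x. snd x i) \<in> borel_measurable (Pi\<^sub>M A (\<lambda>_. borel) \<Otimes>\<^sub>M Pi\<^sub>M B (\<lambda>_. borel))" if "i \<in> B"
      for i :: "mark \<times> nat \<times> nat"
      by (rule measurable_compose[OF measurable_snd measurable_component_singleton[OF that]])
    have "(\<lambda>x. \<psi> (fst x (Power, k, z)) (snd x (Gain, k, z)) (snd x (Fading, k, z)))
        \<in> borel_measurable (Pi\<^sub>M A (\<lambda>_. borel) \<Otimes>\<^sub>M Pi\<^sub>M B (\<lambda>_. borel))"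
      using measurable_compose[OF measurable_Pair[OF mA[OF mem(1)] measurable_Pair[OF mB[OF mem(2)] mB[OF mem(3)]]] \<psi>]
      by (simp only: prod.case)
    then show ?thesis
      using nn_integral_indep_var[OF ind, of "\<lambda>a b. \<psi> (a (Power, k, z)) (b (Gain, k, z)) (b (Fading, k, z))"] mem
      by (simp add: split_beta')
  qed
  have 2: "(\<integral>\<^sup>+w'. \<psi> p (X Gain k z w') (X Fading k z w') \<partial>M)
      = (\<integral>\<^sup>+w. (\<integral>\<^sup>+w'. \<psi> p (X Gain k z w) (X Fading k z w') \<partial>M) \<partial>M)" for p
  proof -
    define A B where "A = {(Gain, k, z)}" and "B = {(Fading, k, z)}"
    have ind: "indep_var (Pi\<^sub>M A (\<lambda>_. borel)) (\<lambda>w. \<lambda>i\<in>A. (\<lambda>(m, k, z). X m k z) i w)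
        (Pi\<^sub>M B (\<lambda>_. borel)) (\<lambda>w. \<lambda>i\<in>B. (\<lambda>(m, k, z). X m k z) i w)"
      by (rule indep_var_restrict[OF indep_marks]) (use i in \<open>auto simp: A_def B_def\<close>)
    have mem: "(Gain, k, z) \<in> A" "(Fading, k, z) \<in> B"
      by (auto simp: A_def B_def)
    have mA: "(\<lambda>x. fst x i) \<in> borel_measurable (Pi\<^sub>M A (\<lambda>_. borel) \<Otimes>\<^sub>M Pi\<^sub>M B (\<lambda>_. borel))" if "i \<in> A"
      for i :: "mark \<times> nat \<times> nat"
      by (rule measurable_compose[OF measurable_fst measurable_component_singleton[OF that]])
    have mB: "(\<lambda>x. snd x i) \<in> borel_measurable (Pi\<^sub>M A (\<lambda>_. borel) \<Otimes>\<^sub>M Pi\<^sub>M B (\<lambda>_. borel))" if "i \<in> B"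
      for i :: "mark \<times> nat \<times> nat"
      by (rule measurable_compose[OF measurable_snd measurable_component_singleton[OF that]])
    have "(\<lambda>x. \<psi> p (fst x (Gain, k, z)) (snd x (Fading, k, z)))
        \<in> borel_measurable (Pi\<^sub>M A (\<lambda>_. borel) \<Otimes>\<^sub>M Pi\<^sub>M B (\<lambda>_. borel))"
      using measurable_compose[OF measurable_Pair[OF measurable_const measurable_Pair[OF mA[OF mem(1)] mB[OF mem(2)]]] \<psi>, of p]
      by (simp only: prod.case) simp
    then show ?thesis
      using nn_integral_indep_var[OF ind, of "\<lambda>a b. \<psi> p (a (Gain, k, z)) (b (Fading, k, z))"] mem
      by (simp add: split_beta')
  qed
  have 3: "(\<integral>\<^sup>+w. \<psi> p g (X Fading k z w) \<partial>M) = (\<integral>\<^sup>+x. ennreal (fading_density S x) * \<psi> p g x \<partial>lborel)" for p g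
    by (rule distributed_nn_integral[OF fading_law[OF i], symmetric]) measurable
  have [measurable]: "(\<lambda>y. \<psi> (fst y) g (snd y)) \<in> borel_measurable (lborel \<Otimes>\<^sub>M lborel)" for g
    using measurable_compose[OF _ \<psi>, of "\<lambda>y. (fst y, g, snd y)" "lborel \<Otimes>\<^sub>M lborel"] by simp
  have 4: "(\<integral>\<^sup>+w. (\<integral>\<^sup>+x. ennreal (fading_density S x) * \<psi> p (X Gain k z w) x \<partial>lborel) \<partial>M)
    = (\<Sum>v=1..4. ennreal (gain_prob S j v) *
        (\<integral>\<^sup>+x. ennreal (fading_density S x) * \<psi> p (gain_val S j v) x \<partial>lborel))" for p
    by (rule gain_average[OF i]) measurable
  show ?thesis
    unfolding 1 2 3 4
    by (rule distributed_nn_integral[OF power_law[OF i], symmetric]) measurable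
qed

text \<open>The power received from an interferer at \<open>u\<close> whose link is in state
  \<open>s\<close>. Position, state and marks are all arguments, so that each can be averaged with
  the others frozen.\<close>

definition contribution :: "link \<Rightarrow> nat \<Rightarrow> plane \<Rightarrow> real \<Rightarrow> real \<Rightarrow> real \<Rightarrow> ennreal" where
  "contribution s k u p g x = (let loss = norm u powr (- plexp S s j) in
     if p * loss < rho S k then ennreal (p * g * x * loss) else 0)"

text \<open>The mean over the fading of 1 minus the exponential of \<open>- t\<close> times the
  contribution, for a link in state \<open>s\<close> with power \<open>p \<ge> 0\<close>, gain value
  number \<open>v\<close> and distance \<open>r\<close>.\<close>

definition truncated_calF :: "real \<Rightarrow> link \<Rightarrow> nat \<Rightarrow> nat \<Rightarrow> real \<Rightarrow> real \<Rightarrow> ennreal" where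
  "truncated_calF t s k v r p = (if p * r powr (- plexp S s j) < rho S k
     then ennreal (calF (nak S) (t * gain_val S j v * p * r powr (- plexp S s j) / real (nak S))) else 0)"

text \<open>The same mean taken over all three marks, for a link known to be in state
  \<open>s\<close>.\<close>

definition link_deficit :: "real \<Rightarrow> link \<Rightarrow> nat \<Rightarrow> real \<Rightarrow> ennreal" where
  "link_deficit t s k r = (\<Sum>v=1..4. ennreal (gain_prob S j v) *
     (\<integral>\<^sup>+p\<in>{0..pmax S}. truncated_calF t s k v r p * ennreal (power_density S k p) \<partial>lborel))"

lemma measurable_contribution [measurable (raw)]:
  assumes [measurable]: "f1 \<in> borel_measurable N" "f2 \<in> borel_measurable N"
    "f3 \<in> borel_measurable N" "f4 \<in> borel_measurable N"
  shows "(\<lambda>w. contribution s k (f1 w) (f2 w) (f3 w) (f4 w)) \<in> borel_measurable N"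
  unfolding contribution_def Let_def by measurable

lemma measurable_power_density: "k \<in> {1..ntiers S} \<Longrightarrow> (\<lambda>p. ennreal (power_density S k p)) \<in> borel_measurable borel"
  using power_law[of k 0] by (auto simp: interferers_def distributed_def)

text \<open>With power and gain fixed the contribution is linear in the fading, so the fading
  integral is a Gamma Laplace transform and gives \<open>calF\<close>; beyond the truncation it is
  0. What remains are the gain sum and the power integral.\<close>

lemma link_average:
  assumes i: "(k, z) \<in> interferers S" and t: "0 \<le> t"
  shows "(\<integral>\<^sup>+w. ennreal (1 - exp_neg (ennreal t * contribution s k u (X Power k z w) (X Gain k z w) (X Fading k z w))) \<partial>M)
    = link_deficit t s k (norm u)"
proof -
  define loss where "loss = norm u powr (- plexp S s j)"
  have loss: "0 \<le> loss"
    by (simp add: loss_def)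
  have k: "k \<in> {1..ntiers S}"
    using i by (simp add: interferers_def)
  note [measurable] = measurable_power_density[OF k]
  have [measurable]: "(\<lambda>p. truncated_calF t s k v r p) \<in> borel_measurable borel" for v r
    unfolding truncated_calF_def by measurable
  have N: "1 \<le> nak S"
    by (rule valid_uplinkD(1)[OF valid])
  have inner: "(\<integral>\<^sup>+x. ennreal (fading_density S x) *
        ennreal (1 - exp_neg (ennreal t * contribution s k u p (gain_val S j v) x)) \<partial>lborel)
      = truncated_calF t s k v (norm u) p" if p: "0 \<le> p" and v: "v \<in> {1..4}" for p v
  proof (cases "p * loss < rho S k")
    case True
    define \<tau> where "\<tau> = t * gain_val S j v * p * loss"
    have \<tau>: "0 \<le> \<tau>"
      using t p loss gain_val_pos[OF valid j v] by (simp add: \<tau>_def)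
    have "(\<integral>\<^sup>+x. ennreal (fading_density S x) *
        ennreal (1 - exp_neg (ennreal t * contribution s k u p (gain_val S j v) x)) \<partial>lborel)
      = (\<integral>\<^sup>+x. ennreal ((1 - exp (- (\<tau> * x))) * erlang_density (nak S - 1) (real (nak S)) x) \<partial>lborel)"
    proof (intro nn_integral_cong)
      fix x
      show "ennreal (fading_density S x) * ennreal (1 - exp_neg (ennreal t * contribution s k u p (gain_val S j v) x))
        = ennreal ((1 - exp (- (\<tau> * x))) * erlang_density (nak S - 1) (real (nak S)) x)"
      proof (cases "x < 0")
        case False
        have "contribution s k u p (gain_val S j v) x = ennreal (p * gain_val S j v * x * loss)"
          using True by (simp add: contribution_def loss_def)
        also have "ennreal t * \<dots> = ennreal (\<tau> * x)"
          using t by (simp add: ennreal_mult'[symmetric] \<tau>_def ac_simps)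
        finally have "exp_neg (ennreal t * contribution s k u p (gain_val S j v) x) = exp (- (\<tau> * x))"
          using \<tau> False by (simp add: exp_neg_ennreal)
        then show ?thesis
          using \<tau> False by (simp add: fading_density_def ennreal_mult'[symmetric] mult.commute)
      qed (simp add: fading_density_def erlang_density_def)
    qed
    also have "\<dots> = ennreal (calF (nak S) (\<tau> / real (nak S)))"
      by (rule nn_integral_erlang_calF[OF N \<tau>])
    finally show ?thesis
      using True by (simp add: truncated_calF_def \<tau>_def loss_def)
  qed (simp add: contribution_def truncated_calF_def loss_def)
  have "(\<integral>\<^sup>+w. ennreal (1 - exp_neg (ennreal t * contribution s k u (X Power k z w) (X Gain k z w) (X Fading k z w))) \<partial>M)
    = (\<integral>\<^sup>+p. ennreal (power_density S k p) * (\<Sum>v=1..4. ennreal (gain_prob S j v) *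
        (\<integral>\<^sup>+x. ennreal (fading_density S x) *
          ennreal (1 - exp_neg (ennreal t * contribution s k u p (gain_val S j v) x)) \<partial>lborel)) \<partial>lborel)"
    by (rule mark_average[OF i]) measurable
  also have "\<dots> = (\<integral>\<^sup>+p. (\<Sum>v=1..4. ennreal (gain_prob S j v) *
       (truncated_calF t s k v (norm u) p * ennreal (power_density S k p) * indicator {0..pmax S} p)) \<partial>lborel)"
  proof (intro nn_integral_cong)
    fix p
    show "ennreal (power_density S k p) * (\<Sum>v=1..4. ennreal (gain_prob S j v) *
        (\<integral>\<^sup>+x. ennreal (fading_density S x) *
          ennreal (1 - exp_neg (ennreal t * contribution s k u p (gain_val S j v) x)) \<partial>lborel))
      = (\<Sum>v=1..4. ennreal (gain_prob S j v) *
       (truncated_calF t s k v (norm u) p * ennreal (power_density S k p) * indicator {0..pmax S} p))"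
    \<comment> \<open>The fading integral was evaluated for \<open>p \<ge> 0\<close> only; outside
      this interval the power density is 0.\<close>
    proof (cases "p \<in> {0..pmax S}")
      case True
      then show ?thesis
        by (simp add: inner sum_distrib_left ac_simps)
    next
      case False
      then have "power_density S k p = 0" "indicator {0..pmax S} p = (0 :: ennreal)"
        by (auto simp: power_density_def)
      then show ?thesis
        by simp
    qed
  qed
  also have "\<dots> = link_deficit t s k (norm u)"
    unfolding link_deficit_def by (simp add: nn_integral_sum nn_integral_cmult)
  finally show ?thesis .
qed

end

section \<open>The Laplace transform of the interference\<close>

context uplink_interferers
begin

text \<open>The expected loss, 1 minus the exponential factor, caused by one interferer at distance
  \<open>r\<close>, averaged over marks and link state. It stays in \<open>ennreal\<close> because
  it is integrated over the plane, where the integral may diverge.\<close>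

definition deficit :: "real \<Rightarrow> nat \<Rightarrow> real \<Rightarrow> ennreal" where
  "deficit t k r = ennreal (exp (- (blk S j * r))) * link_deficit t LoS k r
     + ennreal (1 - exp (- (blk S j * r))) * link_deficit t NLoS k r"

definition link_mix :: "real \<Rightarrow> nat \<Rightarrow> plane \<Rightarrow> real \<Rightarrow> real \<Rightarrow> real \<Rightarrow> real" where
  "link_mix t k u p g x = exp (- (blk S j * norm u)) * exp_neg (ennreal t * contribution LoS k u p g x)
     + (1 - exp (- (blk S j * norm u))) * exp_neg (ennreal t * contribution NLoS k u p g x)"

text \<open>The Laplace transform at \<open>t\<close> of the contribution of one interferer at
  \<open>u\<close>. For \<open>t \<ge> 0\<close> and \<open>k\<close> a tier the deficit turns out
  to be less than 1, so \<open>enn2real\<close> loses nothing.\<close>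

definition retention :: "real \<Rightarrow> nat \<Rightarrow> plane \<Rightarrow> real" where
  "retention t k u = 1 - enn2real (deficit t k (norm u))"

lemma measurable_link_mix [measurable (raw)]:
  assumes [measurable]: "f1 \<in> borel_measurable N" "f2 \<in> borel_measurable N"
    "f3 \<in> borel_measurable N" "f4 \<in> borel_measurable N"
  shows "(\<lambda>w. link_mix t k (f1 w) (f2 w) (f3 w) (f4 w)) \<in> borel_measurable N"
  unfolding link_mix_def by measurable

lemma measurable_deficit:
  assumes "k \<in> {1..ntiers S}"
  shows "deficit t k \<in> borel_measurable borel"
proof -
  note [measurable] = measurable_power_density[OF assms]
  show ?thesis
    unfolding deficit_def[abs_def] link_deficit_def truncated_calF_def by measurable
qed

text \<open>A single contribution is finite, even at the origin. This positivity passes to the mean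
  retention, whose logarithm is taken later.\<close>

lemma exp_neg_term_pos: "0 < exp_neg (ennreal t * contribution s k u p g x)"
proof -
  have "ennreal t * contribution s k u p g x \<noteq> \<top>"
    by (simp add: contribution_def Let_def ennreal_mult_eq_top_iff)
  then show ?thesis
    by (simp add: exp_neg_def)
qed

lemma los_weight: "0 < exp (- (blk S j * norm u))" "exp (- (blk S j * norm (u :: plane))) \<le> 1"
  using blk_pos by auto

lemma link_mix_bounds: "0 < link_mix t k u p g x" "link_mix t k u p g x \<le> 1"
proof -
  show "0 < link_mix t k u p g x"
    unfolding link_mix_def using los_weight[of u]
    by (intro add_pos_nonneg mult_pos_pos exp_neg_term_pos mult_nonneg_nonneg) auto
  show "link_mix t k u p g x \<le> 1"
    unfolding link_mix_def using los_weight[of u]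
    by (intro convex_bound_le) auto
qed

text \<open>For a frozen position \<open>u\<close>, the mixed factor \<open>Y\<close> has values in
  \<open>(0,1]\<close>. Its mean is at most 1, and it is not 0 because \<open>Y\<close> would then
  vanish almost everywhere. Since \<open>1 - Y\<close> is the weighted sum of the losses for the two
  link states, its mean is the deficit. The index \<open>z\<close> serves only as a carrier of the
  mark laws.\<close>

lemma
  assumes i: "(k, z) \<in> interferers S" and t: "0 \<le> t"
  shows mix_average: "(\<integral>\<^sup>+w. ennreal (link_mix t k u (X Power k z w) (X Gain k z w) (X Fading k z w)) \<partial>M)
      = ennreal (retention t k u)"
    and retention_bounds: "0 < retention t k u" "retention t k u \<le> 1"
    and deficit_eq: "ennreal (1 - retention t k u) = deficit t k (norm u)"
proof -
  have [measurable]: "X m k z \<in> borel_measurable M" for m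
    by (rule measurable_X[OF i])
  define e where "e = exp (- (blk S j * norm u))"
  have e: "0 \<le> e" "e \<le> 1"
    using los_weight[of u] by (auto simp: e_def)
  define D where "D s w = exp_neg (ennreal t * contribution s k u (X Power k z w) (X Gain k z w) (X Fading k z w))" for s w
  have [measurable]: "D s \<in> borel_measurable M" for s
    unfolding D_def[abs_def] by measurable
  have D: "0 \<le> D s w" "D s w \<le> 1" for s w
    by (auto simp: D_def)
  define Y where "Y w = link_mix t k u (X Power k z w) (X Gain k z w) (X Fading k z w)" for w
  have Y: "0 < Y w" "Y w \<le> 1" "Y w = e * D LoS w + (1 - e) * D NLoS w" for w
    using link_mix_bounds by (auto simp: Y_def) (simp add: link_mix_def e_def D_def)
  have [measurable]: "Y \<in> borel_measurable M"
    unfolding Y_def[abs_def] by measurable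
  have int: "integrable M Y"
    using Y(1,2) by (intro integrable_const_bound[where B = 1]) (auto simp: less_imp_le)
  have "ennreal (1 - expectation Y) = (\<integral>\<^sup>+w. ennreal (1 - Y w) \<partial>M)"
    using int Y(2) by (subst nn_integral_eq_integral) (auto simp: prob_space)
  also have "\<dots> = (\<integral>\<^sup>+w. ennreal e * ennreal (1 - D LoS w) + ennreal (1 - e) * ennreal (1 - D NLoS w) \<partial>M)"
  proof (intro nn_integral_cong)
    fix w
    have "1 - Y w = e * (1 - D LoS w) + (1 - e) * (1 - D NLoS w)"
      unfolding Y(3) by (simp add: algebra_simps)
    then show "ennreal (1 - Y w) = ennreal e * ennreal (1 - D LoS w) + ennreal (1 - e) * ennreal (1 - D NLoS w)"
      using e D by (simp add: ennreal_mult[symmetric] ennreal_plus[symmetric] del: ennreal_plus)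
  qed
  also have "\<dots> = deficit t k (norm u)"
    using link_average[OF i t, of LoS u] link_average[OF i t, of NLoS u]
    by (simp add: nn_integral_add nn_integral_cmult D_def deficit_def e_def)
  finally have def_eq: "ennreal (1 - expectation Y) = deficit t k (norm u)" .
  have EY1: "expectation Y \<le> 1"
    using int Y(2) by (intro integral_le_const) auto
  then have ret: "retention t k u = expectation Y"
    unfolding retention_def def_eq[symmetric] by simp
  have "expectation Y \<noteq> 0"
  proof
    assume "expectation Y = 0"
    then have "AE w in M. Y w = 0"
      using int Y(1) by (subst (asm) integral_nonneg_eq_0_iff_AE) (auto simp: less_imp_le)
    then have "AE w in M. False"
      by eventually_elim (metis Y(1) less_irrefl)
    then show False
      by simp
  qed
  moreover have "0 \<le> expectation Y"
    using Y(1) by (intro integral_nonneg_AE) (auto simp: less_imp_le)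
  ultimately show "0 < retention t k u"
    by (simp add: ret)
  show "retention t k u \<le> 1"
    using EY1 by (simp add: ret)
  show "ennreal (1 - retention t k u) = deficit t k (norm u)"
    by (simp add: ret def_eq)
  show "(\<integral>\<^sup>+w. ennreal (link_mix t k u (X Power k z w) (X Gain k z w) (X Fading k z w)) \<partial>M)
      = ennreal (retention t k u)"
    using int Y(1) unfolding ret Y_def[symmetric]
    by (intro nn_integral_eq_integral) (auto simp: less_imp_le)
qed

text \<open>The positions are dependent in an unknown way, so they are frozen by their independence
  from the marks. For frozen positions the factors belong to different interferers and are
  independent, and each has its retention as mean.\<close>

lemma mix_product:
  assumes J: "J \<subseteq> interferers S" "finite J" and t: "0 \<le> t"
  shows "(\<integral>\<^sup>+w. (\<Prod>i\<in>J. ennreal (link_mix t (fst i) (positions w i)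
      (marks w (Power, i)) (marks w (Gain, i)) (marks w (Fading, i)))) \<partial>M)
    = (\<integral>\<^sup>+w. (\<Prod>i\<in>J. ennreal (retention t (fst i) (positions w i))) \<partial>M)"
proof -
  let ?PU = "Pi\<^sub>M (interferers S) (\<lambda>_. borel :: plane measure)"
  let ?PX = "Pi\<^sub>M (UNIV \<times> interferers S) (\<lambda>_. borel :: real measure)"
  define f where "f a b = (\<Prod>i\<in>J. ennreal (link_mix t (fst i) (a i) (b (Power, i)) (b (Gain, i)) (b (Fading, i))))"
    for a :: "nat \<times> nat \<Rightarrow> plane" and b :: "mark \<times> nat \<times> nat \<Rightarrow> real"
  have "case_prod f \<in> borel_measurable (?PU \<Otimes>\<^sub>M ?PX)"
    unfolding f_def split_beta'
  proof (rule borel_measurable_prod_ennreal)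
    fix i assume "i \<in> J"
    then have i: "i \<in> interferers S" "(m, i) \<in> UNIV \<times> interferers S" for m :: mark
      using J by auto
    have [measurable]: "(\<lambda>x. fst x i) \<in> borel_measurable (?PU \<Otimes>\<^sub>M ?PX)"
      by (rule measurable_compose[OF measurable_fst measurable_component_singleton[OF i(1)]])
    have [measurable]: "(\<lambda>x. snd x (m, i)) \<in> borel_measurable (?PU \<Otimes>\<^sub>M ?PX)" for m :: mark
      by (rule measurable_compose[OF measurable_snd measurable_component_singleton[OF i(2)[of m]]])
    show "(\<lambda>x. ennreal (link_mix t (fst i) (fst x i) (snd x (Power, i)) (snd x (Gain, i)) (snd x (Fading, i))))
        \<in> borel_measurable (?PU \<Otimes>\<^sub>M ?PX)"
      by measurable
  qed
  then have "(\<integral>\<^sup>+w. f (positions w) (marks w) \<partial>M) = (\<integral>\<^sup>+w. (\<integral>\<^sup>+w'. f (positions w) (marks w') \<partial>M) \<partial>M)"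
    by (rule nn_integral_positions_marks)
  also have "\<dots> = (\<integral>\<^sup>+w. (\<Prod>i\<in>J. ennreal (retention t (fst i) (positions w i))) \<partial>M)"
  proof (intro nn_integral_cong)
    fix w
    let ?Y = "\<lambda>i b. ennreal (link_mix t (fst i) (positions w i) (b (Power, i)) (b (Gain, i)) (b (Fading, i)))"
    \<comment> \<open>The block \<open>UNIV \<times> {i}\<close> collects the three marks of
      interferer \<open>i\<close>; distinct interferers have disjoint blocks.\<close>
    have "indep_vars (\<lambda>i. Pi\<^sub>M (UNIV \<times> {i}) (\<lambda>_. borel))
        (\<lambda>i w'. restrict (\<lambda>l. (\<lambda>(m, k, z). X m k z) l w') (UNIV \<times> {i})) J"
      using J by (intro indep_vars_restrict[OF indep_marks]) (auto simp: disjoint_family_on_def)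
    then have "indep_vars (\<lambda>_. borel) (\<lambda>i w'. ?Y i (restrict (\<lambda>l. (\<lambda>(m, k, z). X m k z) l w') (UNIV \<times> {i}))) J"
    proof (rule indep_vars_compose2)
      fix i assume "i \<in> J"
      have [measurable]: "(\<lambda>b. b (m, i)) \<in> borel_measurable (Pi\<^sub>M (UNIV \<times> {i}) (\<lambda>_. borel :: real measure))" for m :: mark
        by (rule measurable_component_singleton) auto
      show "?Y i \<in> borel_measurable (Pi\<^sub>M (UNIV \<times> {i}) (\<lambda>_. borel :: real measure))"
        by measurable
    qed
    then have "(\<integral>\<^sup>+w'. (\<Prod>i\<in>J. ?Y i (restrict (\<lambda>l. (\<lambda>(m, k, z). X m k z) l w') (UNIV \<times> {i}))) \<partial>M)
       = (\<Prod>i\<in>J. \<integral>\<^sup>+w'. ?Y i (restrict (\<lambda>l. (\<lambda>(m, k, z). X m k z) l w') (UNIV \<times> {i})) \<partial>M)"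
      by (intro indep_vars_nn_integral J(2)) auto
    also have "\<dots> = (\<Prod>i\<in>J. ennreal (retention t (fst i) (positions w i)))"
    proof (intro prod.cong refl)
      fix i assume "i \<in> J"
      then have "(fst i, snd i) \<in> interferers S"
        using J by auto
      from mix_average[OF this t]
      show "(\<integral>\<^sup>+w'. ?Y i (restrict (\<lambda>l. (\<lambda>(m, k, z). X m k z) l w') (UNIV \<times> {i})) \<partial>M)
          = ennreal (retention t (fst i) (positions w i))"
        by (simp add: case_prod_beta)
    qed
    finally show "(\<integral>\<^sup>+w'. f (positions w) (marks w') \<partial>M) = (\<Prod>i\<in>J. ennreal (retention t (fst i) (positions w i)))"
    proof (rule trans[rotated], intro nn_integral_cong)
      fix w'
      show "f (positions w) (marks w')
         = (\<Prod>i\<in>J. ?Y i (restrict (\<lambda>l. (\<lambda>(m, k, z). X m k z) l w') (UNIV \<times> {i})))"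
        unfolding f_def using J by (intro prod.cong) (auto simp: marks_def)
    qed
  qed
  finally show ?thesis
    by (simp add: f_def)
qed

definition weight :: "nat \<Rightarrow> nat \<Rightarrow> 'w \<Rightarrow> ennreal" where
  "weight k z w = contribution (T k z w) k (U k z w) (X Power k z w) (X Gain k z w) (X Fading k z w)"

text \<open>Each interferer is in exactly one link state, so one of its two summands is 0 and the
  other is its weight.\<close>

lemma interference_sum:
  "interference S j U X T LoS k w + interference S j U X T NLoS k w = (\<Sum>z. weight k z w)"
  unfolding interference_def
proof (subst suminf_add[OF summableI summableI], rule suminf_cong)
  fix z
  show "(let loss = norm (U k z w) powr - plexp S LoS j in
        if T k z w = LoS \<and> X Power k z w * loss < rho S k
        then ennreal (X Power k z w * X Gain k z w * X Fading k z w * loss) else 0)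
    + (let loss = norm (U k z w) powr - plexp S NLoS j in
        if T k z w = NLoS \<and> X Power k z w * loss < rho S k
        then ennreal (X Power k z w * X Gain k z w * X Fading k z w * loss) else 0)
    = weight k z w"
    by (cases "T k z w") (simp_all add: weight_def contribution_def Let_def)
qed

lemma measurable_weight: "(k, z) \<in> interferers S \<Longrightarrow> weight k z \<in> borel_measurable M"
proof -
  assume i: "(k, z) \<in> interferers S"
  note [measurable] = measurable_U[OF i] measurable_X[OF i] measurable_T[OF i]
  have "weight k z = (\<lambda>w. if T k z w = LoS then contribution LoS k (U k z w) (X Power k z w) (X Gain k z w) (X Fading k z w)
      else contribution NLoS k (U k z w) (X Power k z w) (X Gain k z w) (X Fading k z w))"
  proof
    fix w
    show "weight k z w = (if T k z w = LoS then contribution LoS k (U k z w) (X Power k z w) (X Gain k z w) (X Fading k z w)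
      else contribution NLoS k (U k z w) (X Power k z w) (X Gain k z w) (X Fading k z w))"
      by (cases "T k z w") (auto simp: weight_def)
  qed
  then show ?thesis
    by simp
qed

text \<open>The link states go first, since their law is conditional on positions and marks; the
  marks follow. Only the positions remain random on the right.\<close>

lemma weight_product:
  assumes J: "J \<subseteq> interferers S" "finite J" and t: "0 \<le> t"
  shows "expectation (\<lambda>w. \<Prod>i\<in>J. exp_neg (ennreal t * weight (fst i) (snd i) w))
    = expectation (\<lambda>w. \<Prod>i\<in>J. retention t (fst i) (U (fst i) (snd i) w))"
proof -
  define D where "D s i w = exp_neg (ennreal t * contribution s (fst i) (U (fst i) (snd i) w)
    (X Power (fst i) (snd i) w) (X Gain (fst i) (snd i) w) (X Fading (fst i) (snd i) w))" for s i w
  let ?mix = "\<lambda>i w. link_mix t (fst i) (positions w i) (marks w (Power, i)) (marks w (Gain, i)) (marks w (Fading, i))"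
  have eq: "positions w i = U (fst i) (snd i) w" "marks w (m, i) = X m (fst i) (snd i) w" if "i \<in> J" for i m w
    using that J by (auto simp: positions_def marks_def case_prod_beta)
  have mU: "U (fst i) (snd i) \<in> borel_measurable M" "X m (fst i) (snd i) \<in> borel_measurable M" if "i \<in> J" for i m
    using that J by (auto intro!: measurable_U measurable_X)
  have "expectation (\<lambda>w. \<Prod>i\<in>J. exp_neg (ennreal t * weight (fst i) (snd i) w))
      = expectation (\<lambda>w. \<Prod>i\<in>J. D (T (fst i) (snd i) w) i w)"
    by (simp add: D_def weight_def)
  also have "\<dots> = expectation (\<lambda>w. \<Prod>i\<in>J. los_prob i w * D LoS i w + (1 - los_prob i w) * D NLoS i w)"
  proof (rule average_links[OF J])
    fix s i assume "i \<in> J"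
    then have i: "(fst i, snd i) \<in> interferers S"
      using J by auto
    note [measurable] = PM_U[OF i] PM_X[OF i]
    show "D s i \<in> borel_measurable position_mark_algebra"
      unfolding D_def[abs_def] by measurable
  qed (simp add: D_def)
  also have "\<dots> = expectation (\<lambda>w. \<Prod>i\<in>J. ?mix i w)"
    by (intro Bochner_Integration.integral_cong prod.cong refl)
      (simp add: eq link_mix_def D_def los_prob_def)
  \<comment> \<open>The marks are averaged with nonnegative integrals, the links with Bochner
    integrals because the coefficients in their expansion change sign.\<close>
  also have "\<dots> = enn2real (\<integral>\<^sup>+w. ennreal (\<Prod>i\<in>J. ?mix i w) \<partial>M)"
  proof (rule integral_eq_nn_integral)
    show "(\<lambda>w. \<Prod>i\<in>J. ?mix i w) \<in> borel_measurable M"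
      using mU by (intro borel_measurable_prod) (simp add: eq)
  qed (auto intro!: prod_nonneg simp: less_imp_le link_mix_bounds)
  also have "(\<integral>\<^sup>+w. ennreal (\<Prod>i\<in>J. ?mix i w) \<partial>M) = (\<integral>\<^sup>+w. (\<Prod>i\<in>J. ennreal (?mix i w)) \<partial>M)"
    by (simp add: prod_ennreal less_imp_le link_mix_bounds)
  also have "\<dots> = (\<integral>\<^sup>+w. (\<Prod>i\<in>J. ennreal (retention t (fst i) (positions w i))) \<partial>M)"
    by (rule mix_product[OF J t])
  also have "\<dots> = (\<integral>\<^sup>+w. ennreal (\<Prod>i\<in>J. retention t (fst i) (U (fst i) (snd i) w)) \<partial>M)"
  proof (intro nn_integral_cong)
    fix w
    have "0 \<le> retention t (fst i) (U (fst i) (snd i) w)" if "i \<in> J" for i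
      using retention_bounds(1)[OF _ t, of "fst i" "snd i"] that J by (auto simp: less_imp_le)
    then show "(\<Prod>i\<in>J. ennreal (retention t (fst i) (positions w i)))
        = ennreal (\<Prod>i\<in>J. retention t (fst i) (U (fst i) (snd i) w))"
      by (simp add: eq prod_ennreal)
  qed
  also have "enn2real \<dots> = expectation (\<lambda>w. \<Prod>i\<in>J. retention t (fst i) (U (fst i) (snd i) w))"
  proof (rule integral_eq_nn_integral[symmetric])
    show "(\<lambda>w. \<Prod>i\<in>J. retention t (fst i) (U (fst i) (snd i) w)) \<in> borel_measurable M"
    proof (rule borel_measurable_prod)
      fix i assume "i \<in> J"
      moreover from this have "fst i \<in> {1..ntiers S}"
        using J by (auto simp: interferers_def)
      note [measurable] = measurable_deficit[OF this]
      note [measurable] = mU[OF \<open>i \<in> J\<close>]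
      show "(\<lambda>w. retention t (fst i) (U (fst i) (snd i) w)) \<in> borel_measurable M"
        unfolding retention_def by measurable
    qed
    show "AE w in M. 0 \<le> (\<Prod>i\<in>J. retention t (fst i) (U (fst i) (snd i) w))"
      using retention_bounds(1)[OF _ t] J
      by (intro AE_I2 prod_nonneg) (auto simp: less_imp_le)
  qed
  finally show ?thesis .
qed

end

lemma eta_nonneg: "0 \<le> eta N"
  by (simp add: eta_def)

text \<open>Binomial theorem with the term \<open>n = 0\<close>, which equals 1, split off; powers
  of \<open>exp_neg x\<close> become multiples of the exponent.\<close>

lemma exp_neg_power_sum:
  "(1 - exp_neg x) ^ N = 1 - (\<Sum>n=1..N. (- 1) ^ (n + 1) * real (N choose n) * exp_neg (of_nat n * x))"
proof -
  have "(1 - exp_neg x) ^ N = (\<Sum>n\<le>N. real (N choose n) * (- exp_neg x) ^ n)"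
    using binomial_ring[of "- exp_neg x" 1 N] by simp
  also have "\<dots> = 1 + (\<Sum>n=1..N. real (N choose n) * (- exp_neg x) ^ n)"
    by (simp add: atMost_atLeast0 sum.atLeast_Suc_atMost)
  also have "(\<Sum>n=1..N. real (N choose n) * (- exp_neg x) ^ n)
      = - (\<Sum>n=1..N. (- 1) ^ (n + 1) * real (N choose n) * exp_neg (of_nat n * x))"
    unfolding sum_negf[symmetric]
    by (intro sum.cong refl) (simp add: exp_neg_of_nat_mult power_minus[of "exp_neg x"])
  finally show ?thesis
    by simp
qed

section \<open>From finitely many interferers to the closed form\<close>

context uplink_interferers
begin

text \<open>One limit statement, \<open>lim\<close>, is used for two families: the scaled weights,
  and the function \<open>g\<close> at the positions. By \<open>weight_product\<close> their finite
  products have the same expectations, so the two limits agree, and the second one is a Laplace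
  functional of the Poisson processes.\<close>

lemma laplace_interference:
  assumes t: "0 \<le> t"
  shows "expectation (\<lambda>w. exp_neg (ennreal t * (\<Sum>k=1..ntiers S. \<Sum>z. weight k z w)))
    = exp_neg (\<Sum>k=1..ntiers S. ennreal (lam S k) * (\<integral>\<^sup>+u. deficit t k (norm (u :: plane)) \<partial>lborel))"
proof -
  let ?K = "{1..ntiers S}"
  define J where "J n = ?K \<times> {..<n}" for n :: nat
  have J: "J n \<subseteq> interferers S" "finite (J n)" for n
    by (auto simp: J_def interferers_def)
  have I: "(k, z) \<in> interferers S" if "k \<in> ?K" for k z
    using that by (simp add: interferers_def)
  \<comment> \<open>Chosen so that \<open>exp_neg (g k u)\<close> is the retention; then
    \<open>1 - exp_neg (g k u)\<close> is the deficit.\<close>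
  define g where "g k u = ennreal (- ln (retention t k u))" for k u
  have ret_meas: "retention t k \<in> borel_measurable borel" if "k \<in> ?K" for k
  proof -
    note [measurable] = measurable_deficit[OF that]
    show ?thesis
      unfolding retention_def[abs_def] by measurable
  qed
  have g_meas: "g k \<in> borel_measurable borel" if "k \<in> ?K" for k
    using ret_meas[OF that] unfolding g_def[abs_def] by measurable
  have g_eq: "exp_neg (g k u) = retention t k u" if "k \<in> ?K" for k u
    unfolding g_def using retention_bounds[OF I[OF that] t, of u] by (intro exp_neg_minus_ln) auto
  have prod_eq: "(\<Prod>i\<in>J n. f (fst i) (snd i)) = (\<Prod>k\<in>?K. \<Prod>z<n. f k z)"
    for n and f :: "nat \<Rightarrow> nat \<Rightarrow> real"
    unfolding J_def by (simp add: prod.cartesian_product case_prod_beta)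
  have lim: "(\<lambda>n. expectation (\<lambda>w. \<Prod>i\<in>J n. exp_neg (f (fst i) (snd i) w)))
      \<longlonglongrightarrow> expectation (\<lambda>w. exp_neg (\<Sum>k\<in>?K. \<Sum>z. f k z w))"
    if f: "\<And>k z. k \<in> ?K \<Longrightarrow> f k z \<in> borel_measurable M" for f :: "nat \<Rightarrow> nat \<Rightarrow> 'w \<Rightarrow> ennreal"
  proof (rule integral_dominated_convergence[where w = "\<lambda>_. 1"])
    note f[measurable]
    show "(\<lambda>w. exp_neg (\<Sum>k\<in>?K. \<Sum>z. f k z w)) \<in> borel_measurable M"
      by measurable
    show "(\<lambda>w. \<Prod>i\<in>J n. exp_neg (f (fst i) (snd i) w)) \<in> borel_measurable M" for n
      unfolding prod_eq[of "\<lambda>k z. exp_neg (f k z _)"]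
      by (intro borel_measurable_prod) measurable
    show "AE w in M. (\<lambda>n. \<Prod>i\<in>J n. exp_neg (f (fst i) (snd i) w)) \<longlonglongrightarrow> exp_neg (\<Sum>k\<in>?K. \<Sum>z. f k z w)"
      unfolding prod_eq[of "\<lambda>k z. exp_neg (f k z _)"] exp_neg_sum
      by (intro AE_I2 tendsto_prod exp_neg_suminf)
    show "AE w in M. norm (\<Prod>i\<in>J n. exp_neg (f (fst i) (snd i) w)) \<le> 1" for n
      by (auto simp: abs_prod intro!: prod_le_1)
  qed auto
  have meas1: "(\<lambda>w. ennreal t * weight k z w) \<in> borel_measurable M" if "k \<in> ?K" for k z
    using measurable_weight[OF I[OF that]] by simp
  have meas2: "(\<lambda>w. g k (U k z w)) \<in> borel_measurable M" if "k \<in> ?K" for k z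
    by (rule measurable_compose[OF measurable_U[OF I[OF that]] g_meas[OF that]])
  have "expectation (\<lambda>w. \<Prod>i\<in>J n. exp_neg (ennreal t * weight (fst i) (snd i) w))
      = expectation (\<lambda>w. \<Prod>i\<in>J n. exp_neg (g (fst i) (U (fst i) (snd i) w)))" for n
    unfolding weight_product[OF J t]
    by (intro Bochner_Integration.integral_cong prod.cong refl) (auto simp: g_eq J_def)
  then have "(\<lambda>n. expectation (\<lambda>w. \<Prod>i\<in>J n. exp_neg (g (fst i) (U (fst i) (snd i) w))))
      \<longlonglongrightarrow> expectation (\<lambda>w. exp_neg (\<Sum>k\<in>?K. \<Sum>z. ennreal t * weight k z w))"
    using lim[of "\<lambda>k z w. ennreal t * weight k z w", OF meas1] by simp
  then have "expectation (\<lambda>w. exp_neg (\<Sum>k\<in>?K. \<Sum>z. ennreal t * weight k z w))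
      = expectation (\<lambda>w. exp_neg (\<Sum>k\<in>?K. \<Sum>z. g k (U k z w)))"
    by (rule LIMSEQ_unique[OF _ lim[of "\<lambda>k z w. g k (U k z w)", OF meas2]])
  also have "\<dots> = exp_neg (\<Sum>k\<in>?K. ennreal (lam S k) * (\<integral>\<^sup>+u. ennreal (1 - exp_neg (g k u)) \<partial>lborel))"
    using valid_uplinkD(3)[OF valid] ppp indep_counts g_meas
    by (intro ppp_laplace) (auto simp: prob_space_axioms less_imp_le)
  also have "\<dots> = exp_neg (\<Sum>k\<in>?K. ennreal (lam S k) * (\<integral>\<^sup>+u. deficit t k (norm (u :: plane)) \<partial>lborel))"
    by (intro arg_cong[where f = exp_neg] sum.cong arg_cong2[where f = "(*)"] nn_integral_cong refl)
      (simp add: g_eq deficit_eq[OF I t])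
  finally show ?thesis
    by (simp add: sum_distrib_left)
qed

text \<open>The common form of \<open>Q_int\<close> and \<open>V_int\<close> without the factor
  \<open>2 * pi * lam S k\<close>; \<open>\<omega>\<close> is the probability of the link state as a
  function of distance.\<close>

definition radial_integral :: "nat \<Rightarrow> nat \<Rightarrow> link \<Rightarrow> (real \<Rightarrow> real) \<Rightarrow> ennreal" where
  "radial_integral n k s \<omega> = (\<Sum>v=1..4. ennreal (gain_prob S j v * q_coef S j n v powr (2 / plexp S s j)) *
     (\<integral>\<^sup>+y\<in>{lower_limit S j s n v k..}. (\<integral>\<^sup>+p\<in>{0..pmax S}.
        ennreal (calF (nak S) (y powr (- plexp S s j) / real (nak S)) *
          \<omega> ((q_coef S j n v * p) powr (1 / plexp S s j) * y) *
          y * p powr (2 / plexp S s j) * power_density S k p) \<partial>lborel) \<partial>lborel))"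

definition laplace_arg :: "nat \<Rightarrow> real" where
  "laplace_arg n = eta (nak S) * real n * thr S j / (rho S j * main_gain S j)"

lemma laplace_arg_pos: "1 \<le> n \<Longrightarrow> 0 < laplace_arg n"
  using valid_uplinkD(1,4,6)[OF valid] j main_gain_pos[OF valid j]
  by (auto simp: laplace_arg_def eta_def)

lemma q_coef_eq: "q_coef S j n v = laplace_arg n * gain_val S j v"
  by (simp add: q_coef_def laplace_arg_def)

text \<open>For each gain value this is \<open>radial_rescale\<close> with \<open>q\<close> the
  product of the Laplace argument and the gain, and with \<open>\<rho>\<close> the power control
  threshold of the tier of the interferer.\<close>

lemma radial_integral_eq:
  assumes k: "k \<in> {1..ntiers S}" and n: "1 \<le> n"
    and [measurable]: "\<omega> \<in> borel_measurable borel" and \<omega>: "\<And>r. 0 \<le> r \<Longrightarrow> 0 \<le> \<omega> r"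
  shows "(\<integral>\<^sup>+r\<in>{0..}. ennreal r * (ennreal (\<omega> r) * link_deficit (laplace_arg n) s k r) \<partial>lborel)
    = radial_integral n k s \<omega>"
proof -
  note [measurable] = measurable_power_density[OF k]
  let ?\<alpha> = "plexp S s j"
  let ?F = "\<lambda>p. ennreal (power_density S k p)"
  let ?I = "\<lambda>v r. (\<integral>\<^sup>+p\<in>{0..pmax S}. truncated_calF (laplace_arg n) s k v r p * ?F p \<partial>lborel)"
  have [measurable]: "(\<lambda>r. ?I v r) \<in> borel_measurable borel" for v
    unfolding truncated_calF_def by measurable
  have "(\<integral>\<^sup>+r\<in>{0..}. ennreal r * (ennreal (\<omega> r) * link_deficit (laplace_arg n) s k r) \<partial>lborel)
    = (\<integral>\<^sup>+r. (\<Sum>v=1..4. ennreal (gain_prob S j v) * (ennreal r * (ennreal (\<omega> r) * ?I v r) * indicator {0..} r)) \<partial>lborel)"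
    unfolding link_deficit_def
    by (intro nn_integral_cong) (simp add: sum_distrib_left sum_distrib_right ac_simps)
  also have "\<dots> = (\<Sum>v=1..4. ennreal (gain_prob S j v) * (\<integral>\<^sup>+r\<in>{0..}. ennreal r * (ennreal (\<omega> r) * ?I v r) \<partial>lborel))"
    by (simp add: nn_integral_sum nn_integral_cmult)
  also have "\<dots> = radial_integral n k s \<omega>"
    unfolding radial_integral_def
  proof (intro sum.cong refl)
    fix v :: nat assume v: "v \<in> {1..4}"
    have q: "0 < q_coef S j n v"
      unfolding q_coef_eq using laplace_arg_pos[OF n] gain_val_pos[OF valid j v] by simp
    have pos: "0 < ?\<alpha>" "0 < rho S k"
      using valid_uplinkD(4)[OF valid k] valid_uplinkD(5)[OF valid j] by auto
    have low: "lower_limit S j s n v k = (q_coef S j n v * rho S k) powr (- 1 / ?\<alpha>)"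
      by (simp add: lower_limit_def q_coef_def)
    have "(\<integral>\<^sup>+r\<in>{0..}. ennreal r * (ennreal (\<omega> r) * ?I v r) \<partial>lborel)
      = ennreal (q_coef S j n v powr (2 / ?\<alpha>)) *
        (\<integral>\<^sup>+y\<in>{lower_limit S j s n v k..}. (\<integral>\<^sup>+p\<in>{0..pmax S}.
          ennreal (calF (nak S) (y powr (- ?\<alpha>) / real (nak S)) *
            \<omega> ((q_coef S j n v * p) powr (1 / ?\<alpha>) * y) * y * p powr (2 / ?\<alpha>)) * ?F p \<partial>lborel) \<partial>lborel)"
      unfolding truncated_calF_def low q_coef_eq[symmetric]
      by (rule radial_rescale) (use \<omega> q pos in auto)
    also have "(\<integral>\<^sup>+y\<in>{lower_limit S j s n v k..}. (\<integral>\<^sup>+p\<in>{0..pmax S}.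
          ennreal (calF (nak S) (y powr (- ?\<alpha>) / real (nak S)) *
            \<omega> ((q_coef S j n v * p) powr (1 / ?\<alpha>) * y) * y * p powr (2 / ?\<alpha>)) * ?F p \<partial>lborel) \<partial>lborel)
      = (\<integral>\<^sup>+y\<in>{lower_limit S j s n v k..}. (\<integral>\<^sup>+p\<in>{0..pmax S}.
          ennreal (calF (nak S) (y powr (- ?\<alpha>) / real (nak S)) *
            \<omega> ((q_coef S j n v * p) powr (1 / ?\<alpha>) * y) * y * p powr (2 / ?\<alpha>) * power_density S k p) \<partial>lborel) \<partial>lborel)"
    proof (rule nn_integral_cong)
      fix y
      show "(\<integral>\<^sup>+p\<in>{0..pmax S}.
          ennreal (calF (nak S) (y powr (- ?\<alpha>) / real (nak S)) *
            \<omega> ((q_coef S j n v * p) powr (1 / ?\<alpha>) * y) * y * p powr (2 / ?\<alpha>)) * ?F p \<partial>lborel) * indicator {lower_limit S j s n v k..} y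
        = (\<integral>\<^sup>+p\<in>{0..pmax S}.
          ennreal (calF (nak S) (y powr (- ?\<alpha>) / real (nak S)) *
            \<omega> ((q_coef S j n v * p) powr (1 / ?\<alpha>) * y) * y * p powr (2 / ?\<alpha>) * power_density S k p) \<partial>lborel) * indicator {lower_limit S j s n v k..} y"
      \<comment> \<open>In the range of integration \<open>y\<close> is nonnegative, so the factor
        in front of the density is too. That suffices for merging the two: a negative density value
        would give 0 on both sides.\<close>
      proof (cases "lower_limit S j s n v k \<le> y")
        case True
        then have y: "0 \<le> y"
          unfolding low by (rule order_trans[rotated]) simp
        have "ennreal (calF (nak S) (y powr (- ?\<alpha>) / real (nak S)) *
            \<omega> ((q_coef S j n v * p) powr (1 / ?\<alpha>) * y) * y * p powr (2 / ?\<alpha>)) * ?F p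
          = ennreal (calF (nak S) (y powr (- ?\<alpha>) / real (nak S)) *
            \<omega> ((q_coef S j n v * p) powr (1 / ?\<alpha>) * y) * y * p powr (2 / ?\<alpha>) * power_density S k p)" for p
          using y \<omega> by (intro ennreal_mult'[symmetric] mult_nonneg_nonneg calF_nonneg) auto
        then show ?thesis
          by simp
      qed simp
    qed
    finally show "ennreal (gain_prob S j v) * (\<integral>\<^sup>+r\<in>{0..}. ennreal r * (ennreal (\<omega> r) * ?I v r) \<partial>lborel)
      = ennreal (gain_prob S j v * q_coef S j n v powr (2 / ?\<alpha>)) *
        (\<integral>\<^sup>+y\<in>{lower_limit S j s n v k..}. (\<integral>\<^sup>+p\<in>{0..pmax S}.
          ennreal (calF (nak S) (y powr (- ?\<alpha>) / real (nak S)) *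
            \<omega> ((q_coef S j n v * p) powr (1 / ?\<alpha>) * y) * y * p powr (2 / ?\<alpha>) * power_density S k p) \<partial>lborel) \<partial>lborel)"
      using gain_prob_nonneg[OF valid j v] by (simp add: ennreal_mult' mult.assoc)
  qed
  finally show ?thesis .
qed

text \<open>Polar coordinates supply \<open>2 * pi * r\<close>. The LOS part of the deficit carries
  the weight \<open>exp (- (blk S j * r))\<close> and gives \<open>Q_int\<close>; the NLOS part
  carries the complementary weight and gives \<open>V_int\<close>.\<close>

lemma deficit_integral:
  assumes k: "k \<in> {1..ntiers S}" and n: "1 \<le> n"
  shows "ennreal (lam S k) * (\<integral>\<^sup>+u. deficit (laplace_arg n) k (norm (u :: plane)) \<partial>lborel)
    = Q_int S j n k + V_int S j n k"
proof -
  note [measurable] = measurable_power_density[OF k]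
  have [measurable]: "link_deficit t s k \<in> borel_measurable borel" for t s
    unfolding link_deficit_def[abs_def] truncated_calF_def by measurable
  let ?\<omega>L = "\<lambda>r. exp (- (blk S j * r))" and ?\<omega>N = "\<lambda>r. 1 - exp (- (blk S j * r))"
  let ?D = "link_deficit (laplace_arg n)"
  have nonneg: "0 \<le> ?\<omega>N r" if "0 \<le> r" for r
    using that blk_pos by simp
  have "(\<integral>\<^sup>+u. deficit (laplace_arg n) k (norm (u :: plane)) \<partial>lborel)
    = (\<integral>\<^sup>+r\<in>{0..}. ennreal (2 * pi * r) * deficit (laplace_arg n) k r \<partial>lborel)"
    by (intro nn_integral_norm_plane measurable_deficit k)
  also have "\<dots> = (\<integral>\<^sup>+r. ennreal (2 * pi) * (ennreal r * (ennreal (?\<omega>L r) * ?D LoS k r) * indicator {0..} r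
      + ennreal r * (ennreal (?\<omega>N r) * ?D NLoS k r) * indicator {0..} r) \<partial>lborel)"
    by (intro nn_integral_cong) (simp add: deficit_def ennreal_mult' distrib_left distrib_right mult.assoc indicator_def)
  also have "\<dots> = ennreal (2 * pi) * (radial_integral n k LoS ?\<omega>L + radial_integral n k NLoS ?\<omega>N)"
    using nonneg by (simp add: nn_integral_cmult nn_integral_add radial_integral_eq[OF k n])
  finally have eq: "ennreal (lam S k) * (\<integral>\<^sup>+u. deficit (laplace_arg n) k (norm (u :: plane)) \<partial>lborel)
      = ennreal (2 * pi * lam S k) * radial_integral n k LoS ?\<omega>L
      + ennreal (2 * pi * lam S k) * radial_integral n k NLoS ?\<omega>N"
    using valid_uplinkD(3)[OF valid k]
    by (simp add: ennreal_mult distrib_left ac_simps)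
  have "Q_int S j n k = ennreal (2 * pi * lam S k) * radial_integral n k LoS ?\<omega>L"
    by (simp add: Q_int_def radial_integral_def Let_def mult.assoc)
  moreover have "V_int S j n k = ennreal (2 * pi * lam S k) * radial_integral n k NLoS ?\<omega>N"
    by (simp add: V_int_def radial_integral_def Let_def mult.assoc)
  ultimately show ?thesis
    using eq by simp
qed

text \<open>In the term of index \<open>n\<close> the noise is deterministic and leaves the
  expectation as a factor; the rest is the Laplace transform of the interference at
  \<open>laplace_arg n\<close>.\<close>

lemma outage_closed_form:
  "outage_prob S j M U X T =
    1 - (\<Sum>n=1..nak S. (- 1) ^ (n + 1) * real (nak S choose n) *
          exp_neg (ennreal (eta (nak S) * real n * thr S j * noise S / (rho S j * main_gain S j))
                   + (\<Sum>k=1..ntiers S. Q_int S j n k + V_int S j n k)))"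
proof -
  define W where "W w = (\<Sum>k=1..ntiers S. \<Sum>z. weight k z w)" for w
  define x where "x w = ennreal (eta (nak S)) *
    (ennreal (thr S j / (rho S j * main_gain S j)) * (ennreal (noise S) + W w))" for w
  have wm: "weight k z \<in> borel_measurable M" if "k \<in> {1..ntiers S}" for k z
    using that by (intro measurable_weight) (simp add: interferers_def)
  have [measurable]: "W \<in> borel_measurable M"
    unfolding W_def[abs_def] using wm by measurable
  have [measurable]: "x \<in> borel_measurable M"
    unfolding x_def[abs_def] by measurable
  have c: "0 \<le> thr S j / (rho S j * main_gain S j)"
    using valid_uplinkD(4,6)[OF valid j] main_gain_pos[OF valid j] by simp
  have x: "of_nat n * x w = ennreal (laplace_arg n * noise S) + ennreal (laplace_arg n) * W w" for n w
  proof -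
    have "ennreal (laplace_arg n) = ennreal (real n * (eta (nak S) * (thr S j / (rho S j * main_gain S j))))"
      by (simp add: laplace_arg_def ac_simps)
    also have "\<dots> = of_nat n * (ennreal (eta (nak S)) * ennreal (thr S j / (rho S j * main_gain S j)))"
      using c eta_nonneg by (simp only: ennreal_mult' of_nat_0_le_iff ennreal_of_nat_eq_real_of_nat)
    finally have "of_nat n * x w = ennreal (laplace_arg n) * (ennreal (noise S) + W w)"
      by (simp add: x_def ac_simps)
    then show ?thesis
      using valid_uplinkD(2)[OF valid] by (simp add: distrib_left ennreal_mult'')
  qed
  have E: "expectation (\<lambda>w. exp_neg (of_nat n * x w))
      = exp_neg (ennreal (eta (nak S) * real n * thr S j * noise S / (rho S j * main_gain S j))
                   + (\<Sum>k=1..ntiers S. Q_int S j n k + V_int S j n k))" if n: "n \<in> {1..nak S}" for n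
  proof -
    have n1: "1 \<le> n"
      using n by simp
    have "expectation (\<lambda>w. exp_neg (of_nat n * x w))
      = exp_neg (ennreal (laplace_arg n * noise S)) * expectation (\<lambda>w. exp_neg (ennreal (laplace_arg n) * W w))"
      by (simp add: x exp_neg_add)
    also have "expectation (\<lambda>w. exp_neg (ennreal (laplace_arg n) * W w))
      = exp_neg (\<Sum>k=1..ntiers S. Q_int S j n k + V_int S j n k)"
      unfolding W_def using laplace_interference[of "laplace_arg n"] laplace_arg_pos[OF n1]
      by (simp add: deficit_integral[OF _ n1])
    also have "laplace_arg n * noise S = eta (nak S) * real n * thr S j * noise S / (rho S j * main_gain S j)"
      by (simp add: laplace_arg_def)
    finally show ?thesis
      by (simp add: exp_neg_add)
  qed
  have int: "integrable M (\<lambda>w. exp_neg (of_nat n * x w))" for n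
    by (intro integrable_const_bound[where B = 1]) auto
  have "outage_prob S j M U X T = expectation (\<lambda>w. (1 - exp_neg (x w)) ^ nak S)"
    by (simp add: outage_prob_def fading_cdf_approx_def interference_sum x_def W_def)
  also have "\<dots> = 1 - (\<Sum>n=1..nak S. (- 1) ^ (n + 1) * real (nak S choose n) * expectation (\<lambda>w. exp_neg (of_nat n * x w)))"
    unfolding exp_neg_power_sum using int by (simp add: prob_space)
  finally show ?thesis
    by (simp only: E cong: sum.cong)
qed

end

theorem theorem4:
  fixes S :: uplink and j :: nat and M :: "'w measure"
    and U :: "nat \<Rightarrow> nat \<Rightarrow> 'w \<Rightarrow> plane"
    and X :: "mark \<Rightarrow> nat \<Rightarrow> nat \<Rightarrow> 'w \<Rightarrow> real"
    and T :: "nat \<Rightarrow> nat \<Rightarrow> 'w \<Rightarrow> link"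
  assumes "valid_uplink S"
    and "j \<in> {1..ntiers S}"
    and "interferer_model S j M U X T"
  shows "outage_prob S j M U X T =
    1 - (\<Sum>n=1..nak S. (- 1) ^ (n + 1) * real (nak S choose n) *
          exp_neg (ennreal (eta (nak S) * real n * thr S j * noise S / (rho S j * main_gain S j))
                   + (\<Sum>k=1..ntiers S. Q_int S j n k + V_int S j n k)))"
proof -
  interpret prob_space M
    using assms(3) by (simp add: interferer_model_def)
  interpret uplink_interferers M S j U X T
    by unfold_locales fact+
  show ?thesis
    by (rule outage_closed_form)
qed

end
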